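(* Let $f : \mathbb{R}_+^2 \to \mathbb{R}$ be a Borel measurable function, and for a closed convex cone $C \in \mathcal{C}_d$ define $$\varphi_f(C) := \mathbb{E}\big[ f\big( \|\Pi_C(g)\|^2,\ \|\Pi_{C^\circ}(g)\|^2 \big) \big],$$ where $g$ is a standard Gaussian vector in $\mathbb{R}^d$. For $k=0,1,\dots,d$ let $L_k$ denote a $k$-dimensional linear subspace of $\mathbb{R}^d$. Then for each $C \in \mathcal{C}_d$, $$\varphi_f(C) = \sum_{k=0}^d \varphi_f(L_k)\cdot v_k(C),$$ provided that all the expectations appearing in this formula (namely $\varphi_f(C)$ and $\varphi_f(L_0),\dots,\varphi_f(L_d)$) are finite.
   Context: Here $\mathbb{R}_+ = [0,\infty)$, and $\mathbb{R}^d$ carries the standard inner product $\langle\cdot,\cdot\rangle$ and Euclidean norm $\|\cdot\|$. Expectations are Lebesgue integrals. Cones. A convex cone $C\subset\mathbb{R}^d$ is a nonempty set with $\tau(x+y)\in C$ for all $\tau>0$, $x,y\in C$; $\mathcal{C}_d$ is the set of closed convex cones in $\mathbb{R}^d$. The polar cone is $C^\circ=\{u\in\mathbb{R}^d:\langle u,x\rangle\le 0 \text{ for all } x\in C\}\in\mathcal{C}_d$ (for a subspace, this is the orthogonal complement). The metric projector onto $C$ is $\Pi_C(x)=\arg\min\{\|x-y\|^2:y\in C\}$. A cone is polyhedral if it is a finite intersection of halfspaces $\{x:\langle u_i,x\rangle\ge0\}$. A face of a polyhedral cone $C$ is a set of the form $\{x\in C:\langle u,x\rangle=\sup_{y\in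 C}\langle u,y\rangle\}$ with $u\in C^\circ$; its dimension is the dimension of its linear hull, and its relative interior is its interior relative to its linear hull. Conic Hausdorff metric. For nonzero $x,y$ put $\mathrm{dist}_s(x,y)=\arccos\big(\langle x,y\rangle/(\|x\|\|y\|)\big)$, with $\mathrm{dist}_s(0,0)=0$ and $\mathrm{dist}_s(x,0)=\mathrm{dist}_s(0,x)=\pi/2$ for $x\ne0$. Put $\mathcal{T}_s(C,\alpha)=\{x\in\mathbb{R}^d:\mathrm{dist}_s(x,y)\le\alpha\text{ for some }y\in C\}$. The conic Hausdorff metric on $\mathcal{C}_d$ is $\mathrm{dist}_{\mathcal H}(C_1,C_2)=\inf\{\alpha\ge0:\mathcal{T}_s(C_1,\alpha)\supset C_2\text{ and }\mathcal{T}_s(C_2,\alpha)\supset C_1\}$. Conic intrinsic volumes. For polyhedral $C\in\mathcal{C}_d$ and $k=0,\dots,d$, $v_k(C)=\mathbb{P}\{\Pi_C(g)\text{ lies in the relative interior of a }k\text{-dimensional face of }C\}$, with $g$ a standard Gaussian vector in $\mathbb{R}^d$. For general $C\in\mathcal{C}_d$, $v_k(C)=\lim_{i\to\infty}v_k(C_i)$ for any sequence of polyhedral cones $C_i\in\mathcal{C}_d$ with $C_i\to C$ in the conic Hausdorff metric (polyhedral cones are dense, and the limit exists and does not depend on the sequence). *)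

theory Defs
  imports "HOL-Probability.Probability"
begin

section \<open>Closed convex cones\<close>

definition closed_convex_cone :: "'a::euclidean_space set \<Rightarrow> bool" where
  "closed_convex_cone C \<longleftrightarrow>
     C \<noteq> {} \<and> closed C \<and> (\<forall>\<tau>>0. \<forall>x\<in>C. \<forall>y\<in>C. \<tau> *\<^sub>R (x + y) \<in> C)"

lemma closed_convex_cone_iff: "closed_convex_cone C \<longleftrightarrow> closed C \<and> convex_cone C"
proof
  assume C: "closed_convex_cone C"
  then obtain x0 where x0: "x0 \<in> C"
    by (auto simp: closed_convex_cone_def)
  have add: "\<tau> *\<^sub>R (x + y) \<in> C" if "\<tau> > 0" "x \<in> C" "y \<in> C" for \<tau> x y
    using C that by (simp add: closed_convex_cone_def)
  have scale: "\<tau> *\<^sub>R x \<in> C" if "\<tau> > 0" "x \<in> C" for \<tau> x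
    using add[of "\<tau> / 2" x x] that by (simp flip: scaleR_2)
  have "(\<lambda>n. (1 / real (Suc n)) *\<^sub>R x0) \<longlonglongrightarrow> 0 *\<^sub>R x0"
    by (intro tendsto_intros LIMSEQ_Suc lim_1_over_n)
  then have zero: "0 \<in> C"
    using closed_sequentially[of C "\<lambda>n. (1 / real (Suc n)) *\<^sub>R x0" 0] C x0 scale
    by (auto simp: closed_convex_cone_def)
  have "convex_cone C"
    unfolding convex_cone_iff
  proof (intro conjI ballI allI impI)
    fix x y assume "x \<in> C" "y \<in> C"
    then show "x + y \<in> C" using add[of 1 x y] by simp
  next
    fix x and c :: real assume "x \<in> C" "c \<ge> 0"
    then show "c *\<^sub>R x \<in> C" using scale[of c x] zero by (cases "c = 0") auto
  qed (use zero in auto)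
  then show "closed C \<and> convex_cone C"
    using C by (simp add: closed_convex_cone_def)
next
  assume "closed C \<and> convex_cone C"
  then show "closed_convex_cone C"
    by (auto simp: closed_convex_cone_def convex_cone_iff)
qed

definition polar_cone :: "'a::euclidean_space set \<Rightarrow> 'a set" where
  "polar_cone C = {u. \<forall>x\<in>C. u \<bullet> x \<le> 0}"

text \<open>The metric projector onto a closed convex cone is the library function \<^const>\<open>closest_point\<close>.\<close>

definition polyhedral_cone :: "'a::euclidean_space set \<Rightarrow> bool" where
  "polyhedral_cone C \<longleftrightarrow> (\<exists>U. finite U \<and> C = {x. \<forall>u\<in>U. 0 \<le> u \<bullet> x})"

lemma polyhedral_cone_imp_closed_convex_cone:
  assumes "polyhedral_cone C"
  shows "closed_convex_cone C"
proof -
  obtain U where C: "C = {x. \<forall>u\<in>U. 0 \<le> u \<bullet> x}"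
    using assms by (auto simp: polyhedral_cone_def)
  have "C = (\<Inter>u\<in>U. {x. 0 \<le> u \<bullet> x})"
    by (auto simp: C)
  then have "closed C"
    by (auto intro!: closed_INT closed_Collect_le continuous_intros)
  moreover have "convex_cone C"
    by (simp add: convex_cone_iff C inner_add_right)
  ultimately show ?thesis
    by (simp add: closed_convex_cone_iff)
qed

definition cone_face :: "'a::euclidean_space set \<Rightarrow> 'a set \<Rightarrow> bool" where
  "cone_face F C \<longleftrightarrow> (\<exists>u\<in>polar_cone C. F = {x \<in> C. u \<bullet> x = (SUP y\<in>C. u \<bullet> y)})"

text \<open>\<^const>\<open>rel_interior\<close> is taken relative to the affine hull. Every face of a polyhedral cone
  contains the origin, so this is the interior relative to the linear hull.\<close>

lemma rel_interior_eq_interior_of_span: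
  fixes F :: "'a::euclidean_space set"
  assumes "0 \<in> F"
  shows "rel_interior F = top_of_set (span F) interior_of F"
proof -
  have "affine hull F = span F"
    using assms by (simp add: affine_hull_span_0 hull_inc)
  then show ?thesis
    by (auto simp: rel_interior_def interior_of_def)
qed

lemma zero_in_cone_face:
  assumes "closed_convex_cone C" "cone_face F C"
  shows "0 \<in> F"
proof -
  obtain u where u: "u \<in> polar_cone C" "F = {x \<in> C. u \<bullet> x = (SUP y\<in>C. u \<bullet> y)}"
    using assms(2) by (auto simp: cone_face_def)
  have zero: "0 \<in> C"
    using assms(1) by (auto simp: closed_convex_cone_iff convex_cone_contains_0)
  have "(SUP y\<in>C. u \<bullet> y) = 0"
    using u(1) zero
    by (intro cSup_eq_maximum) (auto simp: polar_cone_def intro!: image_eqI[of _ _ 0])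
  then show ?thesis
    using zero by (simp add: u(2))
qed


section \<open>The conic Hausdorff metric\<close>

definition dist_s :: "'a::euclidean_space \<Rightarrow> 'a \<Rightarrow> real" where
  "dist_s x y =
     (if x = 0 \<and> y = 0 then 0
      else if x = 0 \<or> y = 0 then pi / 2
      else arccos ((x \<bullet> y) / (norm x * norm y)))"

definition angular_expansion :: "'a::euclidean_space set \<Rightarrow> real \<Rightarrow> 'a set" where
  "angular_expansion C \<alpha> = {x. \<exists>y\<in>C. dist_s x y \<le> \<alpha>}"

definition conic_hausdorff :: "'a::euclidean_space set \<Rightarrow> 'a set \<Rightarrow> real" where
  "conic_hausdorff C1 C2 =
     Inf {\<alpha>. 0 \<le> \<alpha> \<and> C2 \<subseteq> angular_expansion C1 \<alpha> \<and> C1 \<subseteq> angular_expansion C2 \<alpha>}"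


section \<open>Conic intrinsic volumes\<close>

text \<open>The law of a standard Gaussian vector: independent standard normal coordinates. All the
  probabilities and expectations below depend on the Gaussian vector only through its law.\<close>

definition std_gaussian :: "'a::euclidean_space measure" where
  "std_gaussian = density lborel (\<lambda>x. ennreal (\<Prod>b\<in>Basis. std_normal_density (x \<bullet> b)))"

lemma prob_space_std_gaussian: "prob_space (std_gaussian :: 'a::euclidean_space measure)"
proof
  have "emeasure std_gaussian (space (std_gaussian :: 'a measure))
      = (\<integral>\<^sup>+x. (\<Prod>b\<in>Basis. ennreal (std_normal_density (x \<bullet> b))) \<partial>(lborel :: 'a measure))"
    by (simp add: std_gaussian_def emeasure_density prod_ennreal)
  also have "\<dots> = (\<Prod>b\<in>(Basis :: 'a set). \<integral>\<^sup>+x. ennreal (std_normal_density x) \<partial>lborel)"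
    by (rule nn_integral_lborel_prod) auto
  also have "(\<integral>\<^sup>+x. ennreal (std_normal_density x) \<partial>lborel) = 1"
    using prob_space.emeasure_space_1[OF prob_space_normal_density[of 1 0]]
    by (simp add: emeasure_density)
  finally show "emeasure std_gaussian (space (std_gaussian :: 'a measure)) = 1"
    by simp
qed

definition polyhedral_intrinsic_volume :: "nat \<Rightarrow> 'a::euclidean_space set \<Rightarrow> real" where
  "polyhedral_intrinsic_volume k C =
     measure std_gaussian
       {g. \<exists>F. cone_face F C \<and> dim F = k \<and> closest_point C g \<in> rel_interior F}"

text \<open>For a nonpolyhedral cone the value is the common limit along all approximating sequences of
  polyhedral cones; its existence and uniqueness are theorems, not part of the definition.\<close>

definition intrinsic_volume :: "nat \<Rightarrow> 'a::euclidean_space set \<Rightarrow> real" where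
  "intrinsic_volume k C =
     (if polyhedral_cone C then polyhedral_intrinsic_volume k C
      else THE v. \<forall>Cs :: nat \<Rightarrow> 'a set.
             (\<forall>i. polyhedral_cone (Cs i)) \<and> (\<lambda>i. conic_hausdorff (Cs i) C) \<longlonglongrightarrow> 0 \<longrightarrow>
             (\<lambda>i. polyhedral_intrinsic_volume k (Cs i)) \<longlonglongrightarrow> v)"


section \<open>The functional of the projections\<close>

definition projection_functional :: "(real \<times> real \<Rightarrow> real) \<Rightarrow> 'a::euclidean_space set \<Rightarrow> 'a \<Rightarrow> real" where
  "projection_functional f C g =
     f ((norm (closest_point C g))\<^sup>2, (norm (closest_point (polar_cone C) g))\<^sup>2)"

definition phi :: "(real \<times> real \<Rightarrow> real) \<Rightarrow> 'a::euclidean_space set \<Rightarrow> real" where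
  "phi f C = (\<integral>g. projection_functional f C g \<partial>std_gaussian)"

end

theory Submission
  imports Defs
begin

text \<open>For a polyhedral cone, split the space according to the face \<open>F\<close> whose relative interior
  contains the projection of \<open>g\<close>. On that piece the projections onto the cone and its polar are the
  orthogonal projections onto \<open>span F\<close> and its complement, and the piece is invariant under scaling
  these two components separately, so it is independent of their norms. Hence the joint law of the
  squared norms is the mixture of the laws for the subspaces \<open>L\<^sub>k\<close> with weights \<open>v\<^sub>k\<close>. The projector
  is continuous in the conic Hausdorff metric, so the law for a general cone is the weak limit of
  such mixtures. The weights converge as well: exponential moments recover them linearly, because
  the subspace laws have moments \<open>t ^ k\<close> and polynomials are determined by finitely many values.\<close>

subsection \<open>Projections onto cones and subspaces\<close>

text \<open>The function \<open>f\<close> is merely Borel, so a weak limit cannot be applied to it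
  directly. The limit is taken for bounded continuous test functions only; that yields an identity
  between measures of closed sets, then of Borel sets, and then of integrals of nonnegative
  functions with values in [0, infinity]. Integrability enters at the very end, when positive and
  negative parts are subtracted. Two points shape the rest. The weights of a nonpolyhedral cone are
  given by a definite description over all approximating sequences, so convergence along every
  sequence and the existence of one sequence both have to be proved. And independence is obtained
  without polar coordinates: rescaling two orthogonal components multiplies Lebesgue measure by a
  constant, so a set invariant under such rescalings occupies the same proportion of every box of
  squared norms, and the Gaussian density is a function of those squared norms.\<close>

definition proj_sq_norms :: "'a::euclidean_space set \<Rightarrow> 'a \<Rightarrow> real \<times> real" where
  "proj_sq_norms C g =
     ((norm (closest_point C g))\<^sup>2, (norm (closest_point (polar_cone C) g))\<^sup>2)"

lemma projection_functional_eq: "projection_functional f C g = f (proj_sq_norms C g)"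
  by (simp add: projection_functional_def proj_sq_norms_def)

lemma
  assumes "closed_convex_cone C"
  shows closed_cone: "closed C" and convex_coneD: "convex C" and zero_in_cone: "0 \<in> C"
    and cone_nonempty: "C \<noteq> {}"
    and cone_scale: "c \<ge> 0 \<Longrightarrow> x \<in> C \<Longrightarrow> c *\<^sub>R x \<in> C"
  proof -
  show "convex C" using assms by (simp add: closed_convex_cone_iff convex_cone_def)
qed (use assms in \<open>auto simp: closed_convex_cone_iff convex_cone_iff\<close>)

lemma closest_point_in_cone:
  assumes "closed_convex_cone C"
  shows "closest_point C g \<in> C"
  using assms by (simp add: closest_point_in_set closed_cone cone_nonempty)

text \<open>Moreau's criterion. In a cone the variational inequality may be tested at 0 and at
  \<open>2 *\<^sub>R p\<close>; the two tests have opposite signs and force orthogonality. What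
  remains of the inequality is membership of \<open>g - p\<close> in the polar cone.\<close>

lemma closest_point_cone_iff:
  assumes C: "closed_convex_cone C"
  shows "closest_point C g = p \<longleftrightarrow> p \<in> C \<and> g - p \<in> polar_cone C \<and> (g - p) \<bullet> p = 0"
proof
  assume p: "closest_point C g = p"
  have pC: "p \<in> C" using closest_point_in_cone[OF C] p by blast
  have dot: "(g - p) \<bullet> (y - p) \<le> 0" if "y \<in> C" for y
    using closest_point_dot[of C y g] C that by (simp add: p closed_cone convex_coneD)
  have "2 *\<^sub>R p \<in> C" using cone_scale[OF C, of 2 p] pC by simp
  then have "(g - p) \<bullet> p = 0"
    using dot[of "2 *\<^sub>R p"] dot[OF zero_in_cone[OF C]] by (simp add: inner_diff_right)
  with dot pC show "p \<in> C \<and> g - p \<in> polar_cone C \<and> (g - p) \<bullet> p = 0"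
    by (auto simp: polar_cone_def inner_diff_right)
next
  assume p: "p \<in> C \<and> g - p \<in> polar_cone C \<and> (g - p) \<bullet> p = 0"
  have "dist g p \<le> dist g y" if y: "y \<in> C" for y
  proof -
    have "(g - p) \<bullet> (y - p) \<le> 0"
      using p y by (simp add: polar_cone_def inner_diff_right)
    moreover have "(norm (g - y))\<^sup>2 = (norm (g - p))\<^sup>2 - 2 * ((g - p) \<bullet> (y - p)) + (norm (y - p))\<^sup>2"
      by (simp add: power2_norm_eq_inner algebra_simps inner_commute)
    ultimately have "(norm (g - p))\<^sup>2 \<le> (norm (g - y))\<^sup>2"
      by (smt (verit) zero_le_power2)
    then show ?thesis by (simp add: dist_norm)
  qed
  then show "closest_point C g = p"
    using closest_point_unique[of C p g] p C by (simp add: closed_cone convex_coneD)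
qed

lemma closed_convex_cone_polar: "closed_convex_cone (polar_cone C)"
proof -
  have "polar_cone C = (\<Inter>x\<in>C. {u. u \<bullet> x \<le> 0})" by (auto simp: polar_cone_def)
  then have "closed (polar_cone C)"
    by (auto intro!: closed_INT closed_Collect_le continuous_intros)
  then show ?thesis
    by (auto simp: closed_convex_cone_iff convex_cone_iff polar_cone_def inner_add_left
        mult_nonneg_nonpos intro: add_nonpos_nonpos)
qed

text \<open>The conditions of Moreau's criterion are symmetric in \<open>p\<close> and
  \<open>g - p\<close>; the one further fact is that \<open>C\<close> lies in its bipolar.\<close>

lemma closest_point_polar:
  assumes C: "closed_convex_cone C"
  shows "closest_point (polar_cone C) g = g - closest_point C g"
proof -
  define p where "p = closest_point C g"
  have "p \<in> C \<and> g - p \<in> polar_cone C \<and> (g - p) \<bullet> p = 0"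
    using closest_point_cone_iff[OF C] p_def by blast
  then have "closest_point (polar_cone C) g = g - p"
    by (subst closest_point_cone_iff[OF closed_convex_cone_polar])
       (auto simp: polar_cone_def inner_commute)
  then show ?thesis by (simp add: p_def)
qed

lemma proj_sq_norms_cone:
  assumes "closed_convex_cone C"
  shows "proj_sq_norms C g = ((norm (closest_point C g))\<^sup>2, (norm (g - closest_point C g))\<^sup>2)"
  by (simp add: proj_sq_norms_def closest_point_polar[OF assms])

lemma continuous_on_closest_point_cone:
  assumes "closed_convex_cone C"
  shows "continuous_on A (closest_point C)"
  using assms by (simp add: continuous_on_closest_point closed_cone convex_coneD cone_nonempty)

lemma continuous_on_proj_sq_norms:
  assumes "closed_convex_cone C"
  shows "continuous_on A (proj_sq_norms C)"
  unfolding proj_sq_norms_cone[OF assms, abs_def]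
  by (intro continuous_intros continuous_on_closest_point_cone assms)

section \<open>Subspaces as cones: orthogonal projection\<close>

lemma closed_convex_cone_subspace:
  "subspace L \<Longrightarrow> closed_convex_cone L"
  by (simp add: closed_convex_cone_iff closed_subspace convex_cone_iff subspace_0 subspace_add subspace_scale)

text \<open>A functional that is nonpositive at both \<open>y\<close> and \<open>- y\<close>
  vanishes there, so for a subspace the polar condition is orthogonality.\<close>

lemma closest_point_subspace_iff:
  fixes L :: "'a::euclidean_space set"
  assumes L: "subspace L"
  shows "closest_point L g = p \<longleftrightarrow> p \<in> L \<and> (\<forall>y\<in>L. (g - p) \<bullet> y = 0)"
proof -
  have "(\<forall>y\<in>L. (g - p) \<bullet> y = 0)" if "p \<in> L" "g - p \<in> polar_cone L"
  proof
    fix y assume y: "y \<in> L"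
    then have "- y \<in> L" using L by (simp add: subspace_neg)
    with y that show "(g - p) \<bullet> y = 0"
      unfolding polar_cone_def by (smt (verit) inner_minus_right mem_Collect_eq)
  qed
  then show ?thesis
    unfolding closest_point_cone_iff[OF closed_convex_cone_subspace[OF L]]
    by (auto simp: polar_cone_def)
qed

lemma
  fixes L :: "'a::euclidean_space set"
  assumes L: "subspace L"
  shows closest_point_subspace_in: "closest_point L g \<in> L"
    and closest_point_subspace_orth: "y \<in> L \<Longrightarrow> (g - closest_point L g) \<bullet> y = 0"
  using closest_point_subspace_iff[OF L, of g "closest_point L g"] by auto

lemma linear_closest_point_subspace:
  fixes L :: "'a::euclidean_space set"
  assumes L: "subspace L"
  shows "linear (closest_point L)"
proof
  note * = closest_point_subspace_in[OF L] closest_point_subspace_orth[OF L]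
  fix x y :: 'a and c :: real
  have "(x + y - (closest_point L x + closest_point L y)) \<bullet> z = 0" if "z \<in> L" for z
    using *(2)[OF that, of x] *(2)[OF that, of y] by (simp add: algebra_simps)
  then show "closest_point L (x + y) = closest_point L x + closest_point L y"
    by (subst closest_point_subspace_iff[OF L]) (simp add: * L subspace_add)
  have "(c *\<^sub>R x - c *\<^sub>R closest_point L x) \<bullet> z = 0" if "z \<in> L" for z
    using *(2)[OF that, of x] by (simp flip: scaleR_diff_right)
  then show "closest_point L (c *\<^sub>R x) = c *\<^sub>R closest_point L x"
    by (subst closest_point_subspace_iff[OF L]) (simp add: * L subspace_scale)
qed

subsection \<open>Continuity of the projector in the conic Hausdorff metric\<close>

lemma cos_ge_quadratic: "cos x \<ge> 1 - x\<^sup>2 / 2" for x :: real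
proof -
  have "cos x = 1 - 2 * (sin (x / 2))\<^sup>2"
    using cos_double_sin[of "x / 2"] by simp
  moreover have "(sin (x / 2))\<^sup>2 \<le> (x / 2)\<^sup>2"
    using abs_sin_x_le_abs_x[of "x / 2"] by (simp only: abs_le_square_iff)
  ultimately show ?thesis by (simp add: power_divide)
qed

lemma abs_inner_div_norms_le_1: "\<bar>(x \<bullet> y) / (norm x * norm y)\<bar> \<le> 1"
proof -
  have "\<bar>x \<bullet> y\<bar> / (norm x * norm y) \<le> 1"
    using Cauchy_Schwarz_ineq2[of x y] by (intro divide_le_eq_1[THEN iffD2]) auto
  then show ?thesis by (simp add: abs_mult)
qed

lemma dist_s_le_pi: "dist_s x y \<le> pi"
proof -
  have "arccos ((x \<bullet> y) / (norm x * norm y)) \<le> pi"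
    using abs_inner_div_norms_le_1[of x y] by (intro arccos_ubound) linarith+
  then show ?thesis by (simp add: dist_s_def)
qed

text \<open>Rescaling the given point of \<open>D\<close> to the length of \<open>x\<close> turns
  the angle into a chord, and a chord is at most angle times radius by
  \<open>cos_ge_quadratic\<close>. The bound \<open>\<alpha> < pi / 2\<close> excludes the point 0,
  which \<open>dist_s\<close> places at angle \<open>pi / 2\<close> from every nonzero
  vector.\<close>

lemma angular_expansion_near:
  assumes D: "closed_convex_cone D" and x: "x \<in> angular_expansion D \<alpha>"
    and \<alpha>: "0 \<le> \<alpha>" "\<alpha> < pi / 2"
  obtains y where "y \<in> D" "norm (x - y) \<le> \<alpha> * norm x"
proof (cases "x = 0")
  case True
  then show ?thesis using that[of 0] zero_in_cone[OF D] by simp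
next
  case False
  obtain z where z: "z \<in> D" "dist_s x z \<le> \<alpha>"
    using x by (auto simp: angular_expansion_def)
  have z0: "z \<noteq> 0" using z \<alpha> False by (auto simp: dist_s_def)
  define t where "t = (x \<bullet> z) / (norm x * norm z)"
  define y where "y = (norm x / norm z) *\<^sub>R z"
  have yD: "y \<in> D" unfolding y_def by (intro cone_scale[OF D] z) simp
  have t: "\<bar>t\<bar> \<le> 1" unfolding t_def by (rule abs_inner_div_norms_le_1)
  have "arccos t \<le> \<alpha>" using z False z0 by (simp add: dist_s_def t_def)
  then have "cos \<alpha> \<le> cos (arccos t)"
    using t \<alpha> arccos_lbound[of t] by (intro cos_monotone_0_pi_le) (auto simp: abs_le_iff)
  then have "1 - \<alpha>\<^sup>2 / 2 \<le> t"
    using cos_ge_quadratic[of \<alpha>] t by (simp add: cos_arccos_abs)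
  then have "(norm x)\<^sup>2 * (2 * (1 - t)) \<le> (norm x)\<^sup>2 * \<alpha>\<^sup>2"
    by (intro mult_left_mono) auto
  moreover have "(norm (x - y))\<^sup>2 = (norm x)\<^sup>2 * (2 * (1 - t))"
  proof -
    have xz: "x \<bullet> z = t * norm x * norm z" using False z0 by (simp add: t_def)
    have "x \<bullet> y = (norm x)\<^sup>2 * t" using z0 by (simp add: y_def xz power2_eq_square)
    moreover have "norm y = norm x" using z0 by (simp add: y_def)
    moreover have "(norm (x - y))\<^sup>2 = (norm x)\<^sup>2 + (norm y)\<^sup>2 - 2 * (x \<bullet> y)"
      by (simp add: power2_norm_eq_inner inner_diff inner_commute)
    ultimately show ?thesis by (simp add: algebra_simps)
  qed
  ultimately have "(norm (x - y))\<^sup>2 \<le> (\<alpha> * norm x)\<^sup>2"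
    by (simp add: power_mult_distrib mult.commute)
  then have "norm (x - y) \<le> \<alpha> * norm x"
    by (rule power2_le_imp_le) (use \<alpha> in simp)
  with yD show ?thesis by (rule that)
qed

lemma conic_hausdorff_less:
  assumes "closed_convex_cone C1" "closed_convex_cone C2" "conic_hausdorff C1 C2 < e"
  obtains \<alpha> where "0 \<le> \<alpha>" "\<alpha> < e" "C2 \<subseteq> angular_expansion C1 \<alpha>" "C1 \<subseteq> angular_expansion C2 \<alpha>"
proof -
  let ?S = "{\<alpha>. 0 \<le> \<alpha> \<and> C2 \<subseteq> angular_expansion C1 \<alpha> \<and> C1 \<subseteq> angular_expansion C2 \<alpha>}"
  \<comment> \<open>The infimum of an empty set of reals would carry no information. The angle
    \<open>pi\<close> always qualifies because both cones contain 0.\<close>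
  have "pi \<in> ?S"
    using zero_in_cone[OF assms(1)] zero_in_cone[OF assms(2)]
    by (auto simp: angular_expansion_def intro: dist_s_le_pi)
  then have "?S \<noteq> {}" by blast
  from cInf_lessD[OF this, of e] assms(3) obtain \<alpha> where "\<alpha> \<in> ?S" "\<alpha> < e"
    by (auto simp: conic_hausdorff_def)
  with that show ?thesis by auto
qed

lemma norm_closest_point_cone_le:
  assumes C: "closed_convex_cone C"
  shows "norm (closest_point C g) \<le> norm g" "norm (g - closest_point C g) \<le> norm g"
proof -
  define p where "p = closest_point C g"
  have "(g - p) \<bullet> p = 0" using closest_point_cone_iff[OF C] p_def by blast
  then have "(norm g)\<^sup>2 = (norm p)\<^sup>2 + (norm (g - p))\<^sup>2"
    by (simp add: power2_norm_eq_inner algebra_simps inner_commute)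
  then have "(norm p)\<^sup>2 \<le> (norm g)\<^sup>2" "(norm (g - p))\<^sup>2 \<le> (norm g)\<^sup>2" by auto
  then show "norm (closest_point C g) \<le> norm g" "norm (g - closest_point C g) \<le> norm g"
    unfolding p_def[symmetric] by (auto intro: power2_le_imp_le)
qed

text \<open>The obtuse-angle inequality of each projection needs a comparison point in its own cone,
  so \<open>q\<close> and \<open>p\<close> are replaced by nearby points \<open>q'\<close> in
  \<open>C\<close> and \<open>p'\<close> in \<open>D\<close>. Each replacement costs at most
  \<open>\<alpha> * (norm g)\<^sup>2\<close>, and the sum of the two inequalities is the squared
  distance up to these errors.\<close>

lemma closest_point_cone_dist_le:
  assumes C: "closed_convex_cone C" and D: "closed_convex_cone D"
    and \<alpha>: "0 \<le> \<alpha>" "\<alpha> < pi / 2"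
    and CD: "C \<subseteq> angular_expansion D \<alpha>" and DC: "D \<subseteq> angular_expansion C \<alpha>"
  shows "(norm (closest_point C g - closest_point D g))\<^sup>2 \<le> 2 * \<alpha> * (norm g)\<^sup>2"
proof -
  define p where "p = closest_point C g"
  define q where "q = closest_point D g"
  have pC: "p \<in> C" and qD: "q \<in> D"
    by (simp_all add: p_def q_def closest_point_in_cone C D)
  obtain p' where p': "p' \<in> D" "norm (p - p') \<le> \<alpha> * norm p"
    using angular_expansion_near[OF D _ \<alpha>] CD pC by blast
  obtain q' where q': "q' \<in> C" "norm (q - q') \<le> \<alpha> * norm q"
    using angular_expansion_near[OF C _ \<alpha>] DC qD by blast
  have 1: "(g - p) \<bullet> (q' - p) \<le> 0"
    using closest_point_dot[of C q' g] q' C by (simp add: p_def closed_cone convex_coneD)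
  have 2: "(g - q) \<bullet> (p' - q) \<le> 0"
    using closest_point_dot[of D p' g] p' D by (simp add: q_def closed_cone convex_coneD)
  have bound: "u \<bullet> v \<le> \<alpha> * (norm g)\<^sup>2" if "norm u \<le> norm g" "norm v \<le> \<alpha> * norm g" for u v :: 'a
  proof -
    have "u \<bullet> v \<le> norm u * norm v" by (rule norm_cauchy_schwarz)
    also have "\<dots> \<le> norm g * (\<alpha> * norm g)" using that by (intro mult_mono) auto
    finally show ?thesis by (simp add: power2_eq_square algebra_simps)
  qed
  have np: "norm (p - p') \<le> \<alpha> * norm g"
    using p'(2) mult_left_mono[OF norm_closest_point_cone_le(1)[OF C, of g] \<alpha>(1)] by (simp add: p_def)
  have nq: "norm (q - q') \<le> \<alpha> * norm g"
    using q'(2) mult_left_mono[OF norm_closest_point_cone_le(1)[OF D, of g] \<alpha>(1)] by (simp add: q_def)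
  have "(norm (p - q))\<^sup>2 = (g - p) \<bullet> (q' - p) + (g - q) \<bullet> (p' - q) + (g - p) \<bullet> (q - q') + (g - q) \<bullet> (p - p')"
    by (simp add: power2_norm_eq_inner algebra_simps inner_commute)
  also have "\<dots> \<le> 0 + 0 + \<alpha> * (norm g)\<^sup>2 + \<alpha> * (norm g)\<^sup>2"
    using norm_closest_point_cone_le(2)[OF C, of g] norm_closest_point_cone_le(2)[OF D, of g] np nq
    by (intro add_mono 1 2 bound) (simp_all add: p_def q_def)
  finally show ?thesis by (simp add: p_def q_def)
qed

lemma closest_point_conic_hausdorff_tendsto:
  assumes C: "closed_convex_cone C" and Cs: "\<And>i. closed_convex_cone (Cs i)"
    and lim: "(\<lambda>i. conic_hausdorff (Cs i) C) \<longlonglongrightarrow> 0"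
  shows "(\<lambda>i. closest_point (Cs i) g) \<longlonglongrightarrow> closest_point C g"
proof (rule tendstoI)
  fix e :: real assume e: "e > 0"
  \<comment> \<open>Chosen so that \<open>2 * \<alpha> * (norm g)\<^sup>2\<close> stays below
    \<open>e\<^sup>2\<close>. The added 1 keeps the denominator positive when \<open>g = 0\<close>;
    \<open>pi / 2\<close> is the range of the distance bound.\<close>
  define d where "d = min (pi / 2) (e\<^sup>2 / (2 * ((norm g)\<^sup>2 + 1)))"
  have ng: "0 < (norm g)\<^sup>2 + 1" by (smt (verit) zero_le_power2)
  have "d > 0" using e ng by (simp add: d_def)
  then have "\<forall>\<^sub>F i in sequentially. conic_hausdorff (Cs i) C < d"
    using order_tendstoD(2)[OF lim] by simp
  then show "\<forall>\<^sub>F i in sequentially. dist (closest_point (Cs i) g) (closest_point C g) < e"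
  proof eventually_elim
    case (elim i)
    then obtain \<alpha> where \<alpha>: "0 \<le> \<alpha>" "\<alpha> < d" "C \<subseteq> angular_expansion (Cs i) \<alpha>" "Cs i \<subseteq> angular_expansion C \<alpha>"
      using conic_hausdorff_less[OF Cs C] by blast
    have "(norm (closest_point (Cs i) g - closest_point C g))\<^sup>2 \<le> 2 * \<alpha> * (norm g)\<^sup>2"
      using \<alpha> by (intro closest_point_cone_dist_le Cs C) (auto simp: d_def)
    also have "\<dots> \<le> 2 * \<alpha> * ((norm g)\<^sup>2 + 1)" using \<alpha> by (intro mult_left_mono) auto
    also have "\<dots> < 2 * (e\<^sup>2 / (2 * ((norm g)\<^sup>2 + 1))) * ((norm g)\<^sup>2 + 1)"
      using \<alpha> ng by (intro mult_strict_right_mono mult_strict_left_mono) (auto simp: d_def)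
    also have "\<dots> = e\<^sup>2" using ng by (simp add: nonzero_eq_divide_eq field_simps)
    finally show ?case using e by (simp add: dist_norm power2_less_imp_less)
  qed
qed

lemma proj_sq_norms_tendsto:
  assumes "closed_convex_cone C" "\<And>i. closed_convex_cone (Cs i)"
    "(\<lambda>i. conic_hausdorff (Cs i) C) \<longlonglongrightarrow> 0"
  shows "(\<lambda>i. proj_sq_norms (Cs i) g) \<longlonglongrightarrow> proj_sq_norms C g"
  unfolding proj_sq_norms_cone[OF assms(1)] proj_sq_norms_cone[OF assms(2)]
  by (intro tendsto_intros closest_point_conic_hausdorff_tendsto assms)

subsection \<open>Density of polyhedral cones\<close>

text \<open>A polyhedron is cut out by affine inequalities \<open>a h \<bullet> x \<le> b h\<close>.
  In a cone, 0 forces the bounds to be nonnegative, and scaling a point up shows that each bound can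
  be lowered to 0.\<close>

lemma polyhedron_imp_polyhedral_cone:
  assumes P: "polyhedron D" and D: "closed_convex_cone D"
  shows "polyhedral_cone D"
proof -
  obtain F where F: "finite F" "D = \<Inter>F" "\<And>h. h \<in> F \<Longrightarrow> \<exists>a b. a \<noteq> 0 \<and> h = {x. a \<bullet> x \<le> b}"
    using P by (auto simp: polyhedron_def)
  then obtain a b where ab: "\<And>h. h \<in> F \<Longrightarrow> h = {x. a h \<bullet> x \<le> b h}" by metis
  have mem: "x \<in> D \<longleftrightarrow> (\<forall>h\<in>F. a h \<bullet> x \<le> b h)" for x
    unfolding F(2) using ab by blast
  have b: "0 \<le> b h" if "h \<in> F" for h
    using zero_in_cone[OF D] mem[of 0] that by simp
  have a: "a h \<bullet> x \<le> 0" if h: "h \<in> F" and x: "x \<in> D" for h x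
  proof (rule ccontr)
    assume neg: "\<not> a h \<bullet> x \<le> 0"
    \<comment> \<open>With this factor the inner product becomes \<open>b h + 1\<close>, just beyond
      the bound.\<close>
    define c where "c = (b h + 1) / (a h \<bullet> x)"
    have "c *\<^sub>R x \<in> D" using neg b[OF h] by (intro cone_scale[OF D] x) (simp add: c_def)
    then have "a h \<bullet> (c *\<^sub>R x) \<le> b h" using mem h by blast
    then show False using neg by (simp add: c_def)
  qed
  have "D = {x. \<forall>u\<in>(\<lambda>h. - a h) ` F. 0 \<le> u \<bullet> x}"
    using a b by (fastforce simp: mem intro: order_trans)
  with F(1) show ?thesis unfolding polyhedral_cone_def by blast
qed

lemma conic_hausdorff_le:
  assumes "0 \<le> \<alpha>" "C2 \<subseteq> angular_expansion C1 \<alpha>" "C1 \<subseteq> angular_expansion C2 \<alpha>"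
  shows "conic_hausdorff C1 C2 \<le> \<alpha>"
  unfolding conic_hausdorff_def using assms by (intro cInf_lower) (auto intro!: bdd_belowI[of _ 0])

lemma conic_hausdorff_nonneg:
  assumes "closed_convex_cone C1" "closed_convex_cone C2"
  shows "0 \<le> conic_hausdorff C1 C2"
  using conic_hausdorff_less[OF assms, of 0] by fastforce

lemma dist_s_self: "dist_s x x = 0"
  by (simp add: dist_s_def flip: power2_norm_eq_inner) (simp add: power2_eq_square)

text \<open>The approximant is the conic hull of a finite net of unit vectors of \<open>C\<close>.
  It lies inside \<open>C\<close>, so only the expansion of \<open>D\<close> has to be
  examined.\<close>

lemma polyhedral_cone_approx:
  assumes C: "closed_convex_cone C" and e: "0 < e" "e < pi"
  obtains D where "polyhedral_cone D" "conic_hausdorff D C \<le> e"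
proof -
  define K where "K = C \<inter> sphere 0 1"
  have K: "compact K" unfolding K_def by (intro closed_Int_compact closed_cone C) simp
  \<comment> \<open>The distance between two unit vectors at angle \<open>e\<close>: a net of this
    mesh in norm is a net of mesh \<open>e\<close> in angle.\<close>
  define r where "r = sqrt (2 * (1 - cos e))"
  have "cos e < cos 0" using e by (intro cos_monotone_0_pi) auto
  then have r: "r > 0" by (simp add: r_def)
  obtain X where X: "finite X" "X \<subseteq> K" "K \<subseteq> (\<Union>x\<in>X. ball x r)"
    using compactE_image[OF K, of K "\<lambda>x. ball x r"] r
    by (metis (no_types, lifting) UN_I centre_in_ball open_ball subsetI)
  define D where "D = convex_cone hull X"
  have DC: "D \<subseteq> C" unfolding D_def
    using X(2) C by (intro hull_minimal) (auto simp: K_def closed_convex_cone_iff)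
  have poly: "polyhedron D" unfolding D_def using X(1) by (rule polyhedron_convex_cone_hull)
  have D: "closed_convex_cone D"
    using polyhedron_imp_closed[OF poly] by (simp add: closed_convex_cone_iff D_def convex_cone_convex_cone_hull)
  have "C \<subseteq> angular_expansion D e"
  proof
    fix x assume x: "x \<in> C"
    show "x \<in> angular_expansion D e"
    proof (cases "x = 0")
      case True
      then show ?thesis using zero_in_cone[OF D] dist_s_self[of "0 :: 'a"] e
        by (auto simp: angular_expansion_def intro!: bexI[of _ 0])
    next
      case False
      define z where "z = (1 / norm x) *\<^sub>R x"
      have nz: "norm z = 1" using False by (simp add: z_def)
      have "z \<in> C" unfolding z_def by (intro cone_scale[OF C] x) simp
      then have "z \<in> K" using nz by (simp add: K_def)
      then obtain y where y: "y \<in> X" "dist y z < r" using X(3) by auto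
      have ny: "norm y = 1" using X(2) y by (auto simp: K_def)
      have "(norm (y - z))\<^sup>2 < r\<^sup>2" using y(2) by (intro power_strict_mono) (auto simp: dist_norm)
      also have "r\<^sup>2 = 2 * (1 - cos e)" by (simp add: r_def)
      also have "(norm (y - z))\<^sup>2 = 2 - 2 * (z \<bullet> y)"
        using nz ny by (simp add: power2_norm_eq_inner inner_diff norm_eq_1 inner_commute)
      finally have cz: "cos e < z \<bullet> y" by simp
      have zy: "(x \<bullet> y) / (norm x * norm y) = z \<bullet> y" by (simp add: z_def ny)
      have "dist_s x y \<le> e"
      proof -
        have "arccos (z \<bullet> y) \<le> arccos (cos e)"
          using cz abs_inner_div_norms_le_1[of x y]
          by (intro arccos_le_arccos) (auto simp: zy)
        moreover have "y \<noteq> 0" using ny by auto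
        ultimately show ?thesis using False e unfolding dist_s_def zy by (simp add: arccos_cos)
      qed
      moreover have "y \<in> D" unfolding D_def using y(1) by (simp add: hull_inc)
      ultimately show ?thesis by (auto simp: angular_expansion_def)
    qed
  qed
  moreover have "D \<subseteq> angular_expansion C e"
  proof
    fix x assume "x \<in> D"
    then have "x \<in> C" "dist_s x x \<le> e" using DC e by (auto simp: dist_s_self)
    then show "x \<in> angular_expansion C e" unfolding angular_expansion_def by blast
  qed
  ultimately have "conic_hausdorff D C \<le> e" using e by (intro conic_hausdorff_le) auto
  with polyhedron_imp_polyhedral_cone[OF poly D] show ?thesis by (rule that)
qed

lemma polyhedral_cones_dense:
  assumes C: "closed_convex_cone C"
  obtains Cs :: "nat \<Rightarrow> 'a::euclidean_space set"
  where "\<And>i. polyhedral_cone (Cs i)" "(\<lambda>i. conic_hausdorff (Cs i) C) \<longlonglongrightarrow> 0"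
proof -
  have "\<exists>D. polyhedral_cone D \<and> conic_hausdorff D C \<le> inverse (real (Suc i))" for i
  proof -
    have "inverse (real (Suc i)) \<le> 1" by (simp add: inverse_le_1_iff)
    then have "inverse (real (Suc i)) < pi" using pi_gt3 by linarith
    then show ?thesis using polyhedral_cone_approx[OF C, of "inverse (real (Suc i))"] by auto
  qed
  then obtain Cs where Cs: "\<And>i. polyhedral_cone (Cs i)"
    "\<And>i. conic_hausdorff (Cs i) C \<le> inverse (real (Suc i))" by metis
  have "(\<lambda>i. conic_hausdorff (Cs i) C) \<longlonglongrightarrow> 0"
  proof (rule tendsto_sandwich[OF _ _ tendsto_const LIMSEQ_inverse_real_of_nat])
    show "\<forall>\<^sub>F i in sequentially. 0 \<le> conic_hausdorff (Cs i) C"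
      using Cs(1) C by (intro always_eventually allI conic_hausdorff_nonneg)
        (auto intro: polyhedral_cone_imp_closed_convex_cone)
  qed (use Cs(2) in auto)
  with Cs(1) show ?thesis by (rule that)
qed

subsection \<open>Faces of polyhedral cones\<close>

lemma cone_face_iff:
  assumes C: "closed_convex_cone C"
  shows "cone_face F C \<longleftrightarrow> (\<exists>u\<in>polar_cone C. F = {x \<in> C. u \<bullet> x = 0})"
proof -
  have "(SUP y\<in>C. u \<bullet> y) = 0" if "u \<in> polar_cone C" for u
    using that zero_in_cone[OF C]
    by (intro cSup_eq_maximum) (auto simp: polar_cone_def intro!: image_eqI[of _ _ 0])
  then show ?thesis by (auto simp: cone_face_def)
qed

lemma cone_face_imp_face_of:
  assumes C: "closed_convex_cone C" and F: "cone_face F C"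
  shows "F face_of C"
proof -
  obtain u where u: "u \<in> polar_cone C" "F = {x \<in> C. u \<bullet> x = 0}"
    using F cone_face_iff[OF C] by blast
  have "C \<inter> {x. u \<bullet> x = 0} face_of C"
    using u by (intro face_of_Int_supporting_hyperplane_le convex_coneD C) (auto simp: polar_cone_def)
  then show ?thesis by (simp add: u(2) Int_def)
qed

lemma cone_face_closed_convex_cone:
  assumes C: "closed_convex_cone C" and F: "cone_face F C"
  shows "closed_convex_cone F"
proof -
  obtain u where u: "u \<in> polar_cone C" "F = C \<inter> {x. u \<bullet> x = 0}"
    using F by (auto simp: cone_face_iff[OF C])
  have "closed F" unfolding u(2) by (intro closed_Int closed_cone C closed_hyperplane)
  moreover have "convex_cone F" unfolding u(2) convex_cone_iff
    using C by (auto simp: closed_convex_cone_iff convex_cone_iff inner_add_right)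
  ultimately show ?thesis by (simp add: closed_convex_cone_iff)
qed

lemma polyhedral_cone_imp_polyhedron:
  assumes "polyhedral_cone C"
  shows "polyhedron C"
proof -
  obtain U where U: "finite U" "C = (\<Inter>u\<in>U. {x. 0 \<le> u \<bullet> x})"
    using assms by (auto simp: polyhedral_cone_def)
  show ?thesis unfolding U(2) using U(1) by (auto intro!: polyhedron_Inter polyhedron_halfspace_ge)
qed

lemma finite_cone_faces:
  assumes "polyhedral_cone C"
  shows "finite {F. cone_face F C}"
  using finite_polyhedron_faces[OF polyhedral_cone_imp_polyhedron[OF assms]]
  by (rule rev_finite_subset)
     (auto intro: cone_face_imp_face_of polyhedral_cone_imp_closed_convex_cone assms)

text \<open>The face is exposed by minus the sum of the normals of the constraints active at
  \<open>x\<close>. Each summand of that sum is nonnegative on \<open>C\<close>, so the sum vanishes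
  exactly where all active constraints do. The remaining constraints are strict at \<open>x\<close>,
  which makes \<open>x\<close> a relative interior point.\<close>

lemma in_rel_interior_cone_face:
  assumes P: "polyhedral_cone C" and x: "x \<in> C"
  obtains F where "cone_face F C" "x \<in> rel_interior F"
proof -
  note C = polyhedral_cone_imp_closed_convex_cone[OF P]
  obtain U where U: "finite U" "C = {x. \<forall>u\<in>U. 0 \<le> u \<bullet> x}"
    using P by (auto simp: polyhedral_cone_def)
  define I where "I = {u\<in>U. u \<bullet> x = 0}"
  define w where "w = - (\<Sum>u\<in>I. u)"
  have I: "finite I" "I \<subseteq> U" using U(1) by (auto simp: I_def)
  have wy: "w \<bullet> y = - (\<Sum>u\<in>I. u \<bullet> y)" for y by (simp add: w_def inner_sum_left)
  have wpol: "w \<in> polar_cone C"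
    using I by (auto simp: polar_cone_def wy U(2) subset_iff intro!: sum_nonneg)
  define F where "F = {y\<in>C. w \<bullet> y = 0}"
  have F: "cone_face F C" using wpol cone_face_iff[OF C] F_def by blast
  have Fiff: "y \<in> F \<longleftrightarrow> (\<forall>u\<in>U. 0 \<le> u \<bullet> y) \<and> (\<forall>u\<in>I. u \<bullet> y = 0)" for y
    unfolding F_def U(2) wy using I by (auto simp: sum_nonneg_eq_0_iff subset_iff)
  have xF: "x \<in> F" using x by (auto simp: Fiff U(2) I_def)
  have "x \<in> rel_interior F"
  proof (rule convex_rel_interior_only_if)
    show "convex F" "F \<noteq> {}"
      using cone_face_closed_convex_cone[OF C F] by (auto simp: convex_coneD cone_nonempty)
    \<comment> \<open>Prolonging the segment from \<open>y\<close> slightly beyond \<open>x\<close>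
      keeps the active constraints at 0 and the finitely many strict ones positive.\<close>
    show "\<forall>y\<in>F. \<exists>e>1. (1 - e) *\<^sub>R y + e *\<^sub>R x \<in> F"
    proof
      fix y assume y: "y \<in> F"
      have "\<forall>\<^sub>F e in at_right 1. 0 \<le> u \<bullet> ((1 - e) *\<^sub>R y + e *\<^sub>R x)" if u: "u \<in> U" for u
      proof (cases "u \<in> I")
        case True
        then show ?thesis using y by (auto simp: Fiff inner_add_right I_def)
      next
        case False
        then have pos: "0 < u \<bullet> x" using u x by (force simp: I_def U(2))
        have "((\<lambda>e::real. u \<bullet> ((1 - e) *\<^sub>R y + e *\<^sub>R x)) \<longlongrightarrow> u \<bullet> ((1 - 1) *\<^sub>R y + 1 *\<^sub>R x)) (at_right 1)"
          by (intro tendsto_intros)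
        with pos have "\<forall>\<^sub>F e in at_right 1. 0 < u \<bullet> ((1 - e) *\<^sub>R y + e *\<^sub>R x)"
          by (auto dest: order_tendstoD(1))
        then show ?thesis by (rule eventually_mono) simp
      qed
      then have "\<forall>\<^sub>F e in at_right 1. \<forall>u\<in>U. 0 \<le> u \<bullet> ((1 - e) *\<^sub>R y + e *\<^sub>R x)"
        using U(1) by (simp add: eventually_ball_finite_distrib)
      then have "\<forall>\<^sub>F e :: real in at_right 1. 1 < e \<and> (\<forall>u\<in>U. 0 \<le> u \<bullet> ((1 - e) *\<^sub>R y + e *\<^sub>R x))"
        by (intro eventually_conj eventually_at_right_less)
      then obtain e :: real where e: "1 < e" "\<forall>u\<in>U. 0 \<le> u \<bullet> ((1 - e) *\<^sub>R y + e *\<^sub>R x)"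
        using eventually_happens' trivial_limit_at_right_real by blast
      with y show "\<exists>e>1. (1 - e) *\<^sub>R y + e *\<^sub>R x \<in> F"
        by (intro exI[of _ e]) (auto simp: Fiff inner_add_right I_def)
    qed
  qed
  with F show ?thesis by (rule that)
qed

lemma cone_face_unique:
  assumes "closed_convex_cone C" "cone_face F C" "cone_face G C" "x \<in> rel_interior F" "x \<in> rel_interior G"
  shows "F = G"
  using face_of_eq[OF cone_face_imp_face_of[OF assms(1,2)] cone_face_imp_face_of[OF assms(1,3)]] assms(4,5)
  by blast

lemma rel_interior_cone_scale:
  assumes F: "closed_convex_cone F" and c: "c > 0" and x: "x \<in> rel_interior F"
  shows "c *\<^sub>R x \<in> rel_interior F"
proof -
  have "(*\<^sub>R) c ` F = F"
  proof
    show "F \<subseteq> (*\<^sub>R) c ` F"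
    proof
      fix y assume "y \<in> F"
      then have "(1 / c) *\<^sub>R y \<in> F" "y = c *\<^sub>R ((1 / c) *\<^sub>R y)"
        using c cone_scale[OF F, of "1 / c"] by auto
      then show "y \<in> (*\<^sub>R) c ` F" by blast
    qed
    show "(*\<^sub>R) c ` F \<subseteq> F" using c by (auto intro!: cone_scale[OF F])
  qed
  then have "(*\<^sub>R) c ` rel_interior F = rel_interior F"
    using rel_interior_scaleR[of c F] c by simp
  with x show ?thesis by blast
qed

text \<open>The right-hand side puts one condition on the component in \<open>span F\<close> and
  another on the orthogonal component. Each condition survives a positive scaling of its own
  component, which is the invariance required for independence.\<close>

lemma closest_point_in_face_iff:
  assumes C: "closed_convex_cone C" and F: "cone_face F C"
  shows "closest_point C g \<in> rel_interior F \<longleftrightarrow>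
    closest_point (span F) g \<in> rel_interior F \<and> g - closest_point (span F) g \<in> polar_cone C"
    and "closest_point C g \<in> rel_interior F \<Longrightarrow> closest_point C g = closest_point (span F) g"
proof -
  note Fc = cone_face_closed_convex_cone[OF C F]
  have FC: "F \<subseteq> C" using cone_face_imp_face_of[OF C F] by (simp add: face_of_imp_subset)
  show eq: "closest_point C g = closest_point (span F) g" if "closest_point C g \<in> rel_interior F" for g
  proof -
    define p where "p = closest_point C g"
    have p: "p \<in> C" "g - p \<in> polar_cone C" "(g - p) \<bullet> p = 0"
      using closest_point_cone_iff[OF C, of g p] by (auto simp: p_def)
    have pF: "p \<in> F" using that rel_interior_subset by (auto simp: p_def)
    \<comment> \<open>The segment from \<open>z\<close> through \<open>p\<close> can be prolonged
      inside \<open>F\<close> beyond \<open>p\<close>. A functional that is nonpositive at both ends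
      and zero at \<open>p\<close> must vanish at \<open>z\<close>.\<close>
    have "(g - p) \<bullet> z = 0" if z: "z \<in> F" for z
    proof -
      obtain e where e: "e > 1" "(1 - e) *\<^sub>R z + e *\<^sub>R p \<in> F"
        using convex_rel_interior_if[of F p] \<open>closest_point C g \<in> rel_interior F\<close> convex_coneD[OF Fc] z
          hull_inc[of z F affine]
        by (auto simp: p_def)
      have "(g - p) \<bullet> ((1 - e) *\<^sub>R z + e *\<^sub>R p) \<le> 0" using p(2) e(2) FC by (auto simp: polar_cone_def)
      then have "(e - 1) * ((g - p) \<bullet> z) \<ge> 0" using p(3) by (simp add: inner_add_right algebra_simps)
      then have "(g - p) \<bullet> z \<ge> 0" using e(1) by (simp add: zero_le_mult_iff)
      moreover have "(g - p) \<bullet> z \<le> 0" using p(2) z FC by (auto simp: polar_cone_def)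
      ultimately show ?thesis by simp
    qed
    then have "\<forall>z\<in>span F. (g - p) \<bullet> z = 0"
      by (metis orthogonal_def orthogonal_to_span)
    moreover have "p \<in> span F" using pF by (rule span_base)
    ultimately have "closest_point (span F) g = p"
      by (simp add: closest_point_subspace_iff)
    then show ?thesis by (simp add: p_def)
  qed
  show "closest_point C g \<in> rel_interior F \<longleftrightarrow>
    closest_point (span F) g \<in> rel_interior F \<and> g - closest_point (span F) g \<in> polar_cone C"
  proof
    assume "closest_point C g \<in> rel_interior F"
    with eq[of g] closest_point_cone_iff[OF C, of g "closest_point C g"]
    show "closest_point (span F) g \<in> rel_interior F \<and> g - closest_point (span F) g \<in> polar_cone C"
      by auto
  next
    assume *: "closest_point (span F) g \<in> rel_interior F \<and> g - closest_point (span F) g \<in> polar_cone C"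
    define p where "p = closest_point (span F) g"
    have "p \<in> C" using * rel_interior_subset FC by (auto simp: p_def)
    moreover have "(g - p) \<bullet> p = 0"
      unfolding p_def by (intro closest_point_subspace_orth closest_point_subspace_in) auto
    ultimately have "closest_point C g = p"
      using * closest_point_cone_iff[OF C, of g p] by (simp add: p_def)
    with * show "closest_point C g \<in> rel_interior F" by (simp add: p_def)
  qed
qed

subsection \<open>Lebesgue measure under linear bijections\<close>

lemma borel_measurable_linear:
  fixes T :: "'a::euclidean_space \<Rightarrow> 'b::euclidean_space"
  assumes "linear T"
  shows "T \<in> borel_measurable borel"
  by (intro borel_measurable_continuous_onI linear_continuous_on assms[THEN linear_conv_bounded_linear[THEN iffD1]])

lemma nn_integral_lborel_translation:
  fixes f :: "'a::euclidean_space \<Rightarrow> ennreal"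
  assumes [measurable]: "f \<in> borel_measurable borel"
  shows "(\<integral>\<^sup>+x. f (t + x) \<partial>lborel) = (\<integral>\<^sup>+x. f x \<partial>lborel)"
proof -
  have "(\<integral>\<^sup>+x. f x \<partial>lborel) = (\<integral>\<^sup>+x. f x \<partial>distr lborel borel ((+) t))"
    by (simp add: lborel_distr_plus)
  also have "\<dots> = (\<integral>\<^sup>+x. f (t + x) \<partial>lborel)"
    by (subst nn_integral_distr) auto
  finally show ?thesis ..
qed

text \<open>Uniqueness of Haar measure: both sides evaluate the double integral of
  \<open>1\<^sub>A (T z + y) 1\<^sub>B y\<close> over \<open>(y, z)\<close>.\<close>

lemma emeasure_lborel_linear_vimage:
  fixes T :: "'a::euclidean_space \<Rightarrow> 'a"
  assumes T: "linear T" "inj T" and A[measurable]: "A \<in> sets borel" and B[measurable]: "B \<in> sets borel"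
    and sym: "\<And>x. x \<in> B \<longleftrightarrow> - x \<in> B"
  shows "emeasure lborel (T -` A) * emeasure lborel B = emeasure lborel A * emeasure lborel (T -` B)"
proof -
  have [measurable]: "T \<in> borel_measurable borel" by (rule borel_measurable_linear[OF T(1)])
  have surj: "surj T" using T by (simp add: linear_inj_imp_surj)
  have meas: "T -` X \<in> sets borel" if "X \<in> sets borel" for X
    using measurable_sets_borel[OF _ that, of T] by simp
  have 1: "(\<integral>\<^sup>+z. indicator A (T z + y) \<partial>lborel) = emeasure lborel (T -` A)" for y
  proof -
    obtain w where w: "y = T w" using surj by (metis surjD)
    have "(\<integral>\<^sup>+z. indicator A (T z + y) \<partial>lborel) = (\<integral>\<^sup>+z. indicator A (T (w + z)) \<partial>lborel)"
      by (simp add: w linear_add[OF T(1)] add.commute)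
    also have "\<dots> = (\<integral>\<^sup>+z. indicator A (T z) \<partial>lborel)"
      by (rule nn_integral_lborel_translation) simp
    also have "\<dots> = (\<integral>\<^sup>+z. indicator (T -` A) z \<partial>lborel)"
      by (simp add: indicator_def)
    finally show ?thesis using meas[OF A] by simp
  qed
  have 2: "(\<integral>\<^sup>+z. indicator B (y - T z) \<partial>lborel) = emeasure lborel (T -` B)" for y
  proof -
    obtain w where w: "y = T w" using surj by (metis surjD)
    \<comment> \<open>Symmetry of \<open>B\<close> reverses the sign, so that the argument becomes a
      translate under \<open>T\<close>.\<close>
    have "(\<integral>\<^sup>+z. indicator B (y - T z) \<partial>lborel) = (\<integral>\<^sup>+z. indicator B (T (- w + z)) \<partial>lborel)"
      using sym[of "T w - T _"]
      by (intro nn_integral_cong) (simp add: w linear_diff[OF T(1)] indicator_def)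
    also have "\<dots> = (\<integral>\<^sup>+z. indicator B (T z) \<partial>lborel)"
      by (rule nn_integral_lborel_translation) simp
    also have "\<dots> = (\<integral>\<^sup>+z. indicator (T -` B) z \<partial>lborel)"
      by (simp add: indicator_def)
    finally show ?thesis using meas[OF B] by simp
  qed
  have "emeasure lborel (T -` A) * emeasure lborel B
      = (\<integral>\<^sup>+y. emeasure lborel (T -` A) * indicator B y \<partial>lborel)"
    by (simp add: nn_integral_cmult)
  also have "\<dots> = (\<integral>\<^sup>+y. (\<integral>\<^sup>+z. indicator A (T z + y) * indicator B y \<partial>lborel) \<partial>lborel)"
    by (simp add: nn_integral_multc 1)
  also have "\<dots> = (\<integral>\<^sup>+z. (\<integral>\<^sup>+y. indicator A (T z + y) * indicator B y \<partial>lborel) \<partial>lborel)"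
    by (rule lborel_pair.Fubini') simp
  also have "\<dots> = (\<integral>\<^sup>+z. (\<integral>\<^sup>+y. indicator A y * indicator B (y - T z) \<partial>lborel) \<partial>lborel)"
  proof (rule nn_integral_cong)
    fix z :: 'a
    show "(\<integral>\<^sup>+y. indicator A (T z + y) * indicator B y \<partial>lborel)
        = (\<integral>\<^sup>+y. indicator A y * indicator B (y - T z) \<partial>lborel)"
      using nn_integral_lborel_translation[of "\<lambda>y. indicator A y * indicator B (y - T z)" "T z"]
      by simp
  qed
  also have "\<dots> = (\<integral>\<^sup>+y. (\<integral>\<^sup>+z. indicator A y * indicator B (y - T z) \<partial>lborel) \<partial>lborel)"
    by (rule lborel_pair.Fubini') simp
  also have "\<dots> = (\<integral>\<^sup>+y. indicator A y * emeasure lborel (T -` B) \<partial>lborel)"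
    by (simp add: nn_integral_cmult 2)
  also have "\<dots> = emeasure lborel A * emeasure lborel (T -` B)"
    by (simp add: nn_integral_multc)
  finally show ?thesis .
qed

lemma emeasure_lborel_ball_bounds:
  "emeasure lborel (ball (0::'a::euclidean_space) 1) \<noteq> 0" "emeasure lborel (ball (0::'a) 1) \<noteq> \<infinity>"
proof -
  show "emeasure lborel (ball (0::'a) 1) \<noteq> \<infinity>"
    using emeasure_bounded_finite[OF bounded_ball, of "0::'a" 1] by (simp add: less_top)
  show "emeasure lborel (ball (0::'a) 1) \<noteq> 0"
  proof
    assume "emeasure lborel (ball (0::'a) 1) = 0"
    then have "measure lborel (ball (0::'a) 1) = 0" by (simp add: measure_def)
    then show False using content_ball_pos[of 1 "0::'a"] by simp
  qed
qed

text \<open>The unit ball is symmetric and its own preimage, so with it as the reference set the two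
  factors in the Haar comparison cancel.\<close>

lemma distr_lborel_linear_isometry:
  fixes T :: "'a::euclidean_space \<Rightarrow> 'a"
  assumes T: "linear T" "\<And>x. norm (T x) = norm x"
  shows "distr lborel borel T = lborel"
proof (rule measure_eqI)
  have [measurable]: "T \<in> borel_measurable borel" by (rule borel_measurable_linear[OF T(1)])
  have inj: "inj T"
    using T by (auto simp: linear_injective_0) (metis norm_eq_zero)
  fix A assume "A \<in> sets (distr lborel borel T)"
  then have A: "A \<in> sets borel" by simp
  have "T -` ball 0 1 = ball 0 1" by (auto simp: T(2))
  then have "emeasure lborel (ball (0::'a) 1) * emeasure lborel (T -` A) = emeasure lborel (ball (0::'a) 1) * emeasure lborel A"
    using emeasure_lborel_linear_vimage[OF T(1) inj A, of "ball 0 1"] by (simp add: mult.commute)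
  then have "emeasure lborel (T -` A) = emeasure lborel A"
    using emeasure_lborel_ball_bounds[where 'a='a] by (simp add: ennreal_mult_cancel_left)
  with A show "emeasure (distr lborel borel T) A = emeasure lborel A"
    by (simp add: emeasure_distr)
qed simp

text \<open>The constant is the reciprocal of the absolute determinant, obtained here as a ratio of
  volumes with the unit ball. It cancels later, where two sets are pulled back by the same
  map.\<close>

lemma emeasure_lborel_linear_bij_scale:
  fixes T :: "'a::euclidean_space \<Rightarrow> 'a"
  assumes T: "linear T" "inj T"
  obtains c where "\<And>A. A \<in> sets borel \<Longrightarrow> emeasure lborel (T -` A) = c * emeasure lborel A"
proof
  let ?B = "ball (0::'a) 1"
  fix A :: "'a set" assume A: "A \<in> sets borel"
  have "emeasure lborel (T -` A) = emeasure lborel (T -` A) * emeasure lborel ?B / emeasure lborel ?B"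
    using emeasure_lborel_ball_bounds[where 'a='a] by (intro ennreal_mult_divide_eq[symmetric]) auto
  also have "emeasure lborel (T -` A) * emeasure lborel ?B = emeasure lborel (T -` ?B) * emeasure lborel A"
    using emeasure_lborel_linear_vimage[OF T A, of ?B] by (simp add: mult.commute)
  finally show "emeasure lborel (T -` A) = emeasure lborel (T -` ?B) / emeasure lborel ?B * emeasure lborel A"
    by (simp only: ennreal_divide_times ennreal_times_divide[symmetric])
qed

subsection \<open>Rotation invariance of the Gaussian measure\<close>

text \<open>The radial form of the density: rotation invariance uses it, and so does writing the
  density in terms of the two squared norms.\<close>

lemma std_gaussian_eq:
  "std_gaussian = density lborel (\<lambda>x::'a::euclidean_space.
     ennreal ((1 / sqrt (2 * pi)) ^ DIM('a) * exp (- (norm x)\<^sup>2 / 2)))"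
proof -
  have "(\<Prod>b\<in>Basis. std_normal_density (x \<bullet> b)) = (1 / sqrt (2 * pi)) ^ DIM('a) * exp (- (norm x)\<^sup>2 / 2)" for x :: 'a
  proof -
    have "(norm x)\<^sup>2 = (\<Sum>b\<in>Basis. (x \<bullet> b)\<^sup>2)"
      unfolding power2_norm_eq_inner by (subst euclidean_inner) (simp add: power2_eq_square)
    then have "exp (- (norm x)\<^sup>2 / 2) = (\<Prod>b\<in>Basis. exp (- (x \<bullet> b)\<^sup>2 / 2))"
      by (simp add: exp_sum[symmetric] sum_negf sum_divide_distrib)
    then show ?thesis by (simp add: normal_density_def prod.distrib power_divide prod_dividef)
  qed
  then show ?thesis by (simp add: std_gaussian_def)
qed

lemma
  shows sets_std_gaussian[simp, measurable_cong]: "sets std_gaussian = sets borel"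
    and space_std_gaussian[simp]: "space std_gaussian = UNIV"
  by (auto simp: std_gaussian_def)

lemma distr_std_gaussian_linear_isometry:
  fixes T :: "'a::euclidean_space \<Rightarrow> 'a"
  assumes T: "linear T" "\<And>x. norm (T x) = norm x"
  shows "distr std_gaussian borel T = std_gaussian"
proof -
  have [measurable]: "T \<in> borel_measurable borel" by (rule borel_measurable_linear[OF T(1)])
  let ?g = "\<lambda>x::'a. ennreal ((1 / sqrt (2 * pi)) ^ DIM('a) * exp (- (norm x)\<^sup>2 / 2))"
  have "density (distr lborel borel T) ?g = distr (density lborel (\<lambda>x. ?g (T x))) borel T"
    by (rule density_distr) auto
  then show ?thesis
    by (simp only: T(2) distr_lborel_linear_isometry[OF T] std_gaussian_eq)
qed

text \<open>An isometry from \<open>L\<close> onto \<open>M\<close> alone need not preserve norms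
  elsewhere. It is glued to an isometry between the orthogonal complements, which have equal
  dimension; the result acts on the whole space and intertwines the projections.\<close>

lemma exists_linear_isometry_subspace:
  fixes L M :: "'a::euclidean_space set"
  assumes L: "subspace L" and M: "subspace M" and dim: "dim L = dim M"
  obtains T where "linear T" "\<And>x. norm (T x) = norm x"
    "\<And>x. closest_point M (T x) = T (closest_point L x)"
proof -
  define L' where "L' = {y. \<forall>x\<in>L. orthogonal x y}"
  define M' where "M' = {y. \<forall>x\<in>M. orthogonal x y}"
  have sub: "subspace L'" "subspace M'" unfolding L'_def M'_def by (rule subspace_orthogonal_to_vectors)+
  have "dim L' + dim L = DIM('a)" "dim M' + dim M = DIM('a)"
    using dim_subspace_orthogonal_to_vectors[OF L subspace_UNIV] dim_subspace_orthogonal_to_vectors[OF M subspace_UNIV]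
    by (auto simp: L'_def M'_def)
  then have dim': "dim L' = dim M'" using dim by simp
  obtain f where f: "linear f" "f ` L = M" "\<And>x. x \<in> L \<Longrightarrow> norm (f x) = norm x"
    using isometries_subspaces[OF L M dim] by metis
  obtain f' where f': "linear f'" "f' ` L' = M'" "\<And>x. x \<in> L' \<Longrightarrow> norm (f' x) = norm x"
    using isometries_subspaces[OF sub dim'] by metis
  define P where "P = closest_point L"
  have P: "linear P" unfolding P_def by (rule linear_closest_point_subspace[OF L])
  have PL: "P x \<in> L" "x - P x \<in> L'" for x
    using closest_point_subspace_in[OF L] closest_point_subspace_orth[OF L]
    by (auto simp: P_def L'_def orthogonal_def inner_commute)
  define T where "T x = f (P x) + f' (x - P x)" for x
  have orth: "(f' v) \<bullet> u = 0" if "v \<in> L'" "u \<in> M" for u v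
  proof -
    have "f' v \<in> M'" using f'(2) that(1) by blast
    then show ?thesis using that(2) by (simp add: M'_def orthogonal_def inner_commute)
  qed
  show ?thesis
  proof
    have "linear (\<lambda>x. x - P x)" by (intro linear_compose_sub linear_ident P)
    then show "linear T" unfolding T_def
      using linear_compose[OF P f(1)] linear_compose[OF _ f'(1)]
      by (intro linear_compose_add) (auto simp: o_def)
    fix x
    have fM: "f (P x) \<in> M" using f(2) PL by blast
    have "(norm (T x))\<^sup>2 = (norm (f (P x)))\<^sup>2 + (norm (f' (x - P x)))\<^sup>2"
      using orth[OF PL(2) fM, of x] by (simp add: T_def power2_norm_eq_inner inner_add inner_commute)
    also have "\<dots> = (norm (P x))\<^sup>2 + (norm (x - P x))\<^sup>2" using f(3) f'(3) PL by simp
    also have "\<dots> = (norm x)\<^sup>2"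
    proof -
      have "P x \<bullet> (x - P x) = 0" using PL[of x] by (auto simp: L'_def orthogonal_def)
      then show ?thesis by (simp add: power2_norm_eq_inner algebra_simps inner_commute)
    qed
    finally show "norm (T x) = norm x" by simp
    have "P (P x) = P x" using PL(1) unfolding P_def by (rule closest_point_self)
    then have "T (P x) = f (P x)" using linear_0[OF f'(1)] by (simp add: T_def)
    moreover have "closest_point M (T x) = f (P x)"
      using fM orth PL(2) by (auto simp: closest_point_subspace_iff[OF M] T_def)
    ultimately show "closest_point M (T x) = T (closest_point L x)" by (simp add: P_def)
  qed
qed

lemma borel_measurable_proj_sq_norms:
  "closed_convex_cone C \<Longrightarrow> proj_sq_norms C \<in> borel_measurable borel"
  by (intro borel_measurable_continuous_onI continuous_on_proj_sq_norms)

text \<open>This makes the choice of the subspaces \<open>L k\<close> immaterial and lets the span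
  of a face be exchanged for one of them.\<close>

lemma distr_proj_sq_norms_subspace_cong:
  fixes L M :: "'a::euclidean_space set"
  assumes L: "subspace L" and M: "subspace M" and dim: "dim L = dim M"
  shows "distr std_gaussian borel (proj_sq_norms L) = distr std_gaussian borel (proj_sq_norms M)"
proof -
  obtain T where T: "linear T" "\<And>x. norm (T x) = norm x" "\<And>x. closest_point M (T x) = T (closest_point L x)"
    using exists_linear_isometry_subspace[OF L M dim] by metis
  note [measurable] = borel_measurable_linear[OF T(1)]
    borel_measurable_proj_sq_norms[OF closed_convex_cone_subspace[OF M]]
  have "proj_sq_norms L = proj_sq_norms M \<circ> T"
    by (auto simp: fun_eq_iff proj_sq_norms_cone closed_convex_cone_subspace L M T(2,3)
        simp flip: linear_diff[OF T(1)])
  then have "distr std_gaussian borel (proj_sq_norms L)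
      = distr (distr std_gaussian borel T) borel (proj_sq_norms M)"
    by (simp add: distr_distr)
  then show ?thesis by (simp add: distr_std_gaussian_linear_isometry[OF T(1,2)])
qed

subsection \<open>Independence of norms and directions\<close>

text \<open>The group action behind the independence argument. Invariance of a set under all
  positive \<open>r\<close> and \<open>s\<close> says that membership depends only on the directions
  of the two components.\<close>

definition biscale :: "'a::euclidean_space set \<Rightarrow> real \<Rightarrow> real \<Rightarrow> 'a \<Rightarrow> 'a" where
  "biscale L r s x = r *\<^sub>R closest_point L x + s *\<^sub>R (x - closest_point L x)"

lemma linear_biscale: "subspace L \<Longrightarrow> linear (biscale L r s)"
  unfolding biscale_def[abs_def]
  by (intro linear_compose_add linear_compose_scale_right linear_compose_sub linear_ident linear_closest_point_subspace)

lemma closest_point_biscale: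
  fixes L :: "'a::euclidean_space set"
  assumes L: "subspace L"
  shows "closest_point L (biscale L r s x) = r *\<^sub>R closest_point L x"
  unfolding closest_point_subspace_iff[OF L] biscale_def
  using closest_point_subspace_in[OF L, of x] closest_point_subspace_orth[OF L, of _ x] L
  by (auto simp: subspace_scale)

lemma biscale_biscale:
  "subspace L \<Longrightarrow> biscale L r s (biscale L r' s' x) = biscale L (r * r') (s * s') x"
  by (subst (1) biscale_def) (auto simp: closest_point_biscale, auto simp: biscale_def)

lemma biscale_1_1: "biscale L 1 1 x = x"
  by (simp add: biscale_def)

lemma proj_sq_norms_biscale:
  assumes "subspace L"
  shows "proj_sq_norms L (biscale L r s x)
    = (r\<^sup>2 * fst (proj_sq_norms L x), s\<^sup>2 * snd (proj_sq_norms L x))"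
proof -
  have "biscale L r s x - r *\<^sub>R closest_point L x = s *\<^sub>R (x - closest_point L x)"
    by (simp add: biscale_def)
  then show ?thesis
    by (simp add: proj_sq_norms_cone closed_convex_cone_subspace closest_point_biscale assms power_mult_distrib)
qed

text \<open>These quadrants are the right generator because their preimages under
  \<open>proj_sq_norms\<close>, when nonempty, are all obtained from a single bounded set by
  \<open>biscale\<close>.\<close>

lemma borel_prod_eq_lessThan_rectangles:
  "(borel :: (real \<times> real) measure) = sigma UNIV (range (\<lambda>(a, b). {..<a} \<times> {..<b}))" (is "_ = ?S")
proof (rule measure_eqI)
  let ?E = "range (\<lambda>(a::real, b::real). {..<a} \<times> {..<b})"
  show "sets (borel :: (real \<times> real) measure) = sets ?S"
  proof
    have "?E \<subseteq> sets (borel :: (real \<times> real) measure)"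
      by (auto intro!: borel_open open_Times)
    then show "sets ?S \<subseteq> sets (borel :: (real \<times> real) measure)"
      by (simp add: sets.sigma_sets_subset[of _ borel, simplified])
    have 1: "fst \<in> measurable ?S borel"
    proof (rule borel_measurableI_less)
      fix y :: real
      have "{x \<in> space ?S. fst x < y} = (\<Union>n::nat. {..<y} \<times> {..<real n})"
        using reals_Archimedean2 by auto
      also have "\<dots> \<in> sets ?S"
        by (intro sets.countable_UN) (auto intro!: sigma_sets.Basic)
      finally show "{x \<in> space ?S. fst x < y} \<in> sets ?S" .
    qed
    have 2: "snd \<in> measurable ?S borel"
    proof (rule borel_measurableI_less)
      fix y :: real
      have "{x \<in> space ?S. snd x < y} = (\<Union>n::nat. {..<real n} \<times> {..<y})"
        using reals_Archimedean2 by auto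
      also have "\<dots> \<in> sets ?S"
        by (intro sets.countable_UN) (auto intro!: sigma_sets.Basic)
      finally show "{x \<in> space ?S. snd x < y} \<in> sets ?S" .
    qed
    have "(\<lambda>x. (fst x, snd x)) \<in> measurable ?S (borel \<Otimes>\<^sub>M borel)"
      using 1 2 by (rule measurable_Pair)
    then have id: "(\<lambda>x. x) \<in> measurable ?S borel" by (simp add: borel_prod)
    show "sets (borel :: (real \<times> real) measure) \<subseteq> sets ?S"
      using measurable_sets[OF id] by auto
  qed
\<comment> \<open>Equality of measures also compares values; both sides carry the zero
  measure.\<close>
qed (auto simp: emeasure_sigma borel_def)


lemma sum_proj_sq_norms:
  assumes L: "subspace L"
  shows "fst (proj_sq_norms L x) + snd (proj_sq_norms L x) = (norm x)\<^sup>2"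
proof -
  have "(x - closest_point L x) \<bullet> closest_point L x = 0"
    by (intro closest_point_subspace_orth closest_point_subspace_in L)
  then show ?thesis
    by (simp add: proj_sq_norms_cone closed_convex_cone_subspace L power2_norm_eq_inner
        algebra_simps inner_commute)
qed

text \<open>Let \<open>U\<close> be the region where both squared norms are below 1. Rescaling the
  two components turns \<open>U\<close> into any other box of squared norms and fixes
  \<open>S\<close>, so Lebesgue measure of the box and of its part in \<open>S\<close> change by the
  same factor. The proportion \<open>k / K\<close> is therefore common to all boxes, hence to all
  Borel conditions on the norms, and it passes to the Gaussian law because the density factors
  through \<open>N\<close>.\<close>

lemma std_gaussian_bicone_indep:
  fixes L :: "'a::euclidean_space set"
  assumes L: "subspace L" and S[measurable]: "S \<in> sets borel"
    and bic: "\<And>r s x. r > 0 \<Longrightarrow> s > 0 \<Longrightarrow> x \<in> S \<Longrightarrow> biscale L r s x \<in> S"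
    and E[measurable]: "E \<in> sets borel"
  shows "emeasure std_gaussian (S \<inter> proj_sq_norms L -` E)
    = emeasure std_gaussian S * emeasure std_gaussian (proj_sq_norms L -` E)"
proof -
  define N where "N = proj_sq_norms L"
  have N[measurable]: "N \<in> borel_measurable borel"
    unfolding N_def by (intro borel_measurable_proj_sq_norms closed_convex_cone_subspace L)
  have NE[measurable]: "N -` A \<in> sets borel" if "A \<in> sets borel" for A
    using measurable_sets_borel[OF N that] by simp
  have N_pos: "0 \<le> fst (N x)" "0 \<le> snd (N x)" for x
    by (simp_all add: N_def proj_sq_norms_def)
  have rect[measurable]: "{..<a} \<times> {..<b} \<in> sets (borel :: (real \<times> real) measure)" for a b :: real
    by (intro borel_open open_Times) auto
  have fin: "emeasure lborel (N -` ({..<a} \<times> {..<b})) < \<infinity>" for a b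
  proof -
    have "N -` ({..<a} \<times> {..<b}) \<subseteq> ball 0 (sqrt (a + b))"
    proof
      fix x assume x: "x \<in> N -` ({..<a} \<times> {..<b})"
      have "(norm x)\<^sup>2 < a + b"
        using x sum_proj_sq_norms[OF L, of x] by (auto simp: N_def mem_Times_iff)
      then have "sqrt ((norm x)\<^sup>2) < sqrt (a + b)" by (rule real_sqrt_less_mono)
      then show "x \<in> ball 0 (sqrt (a + b))" by simp
    qed
    then have "bounded (N -` ({..<a} \<times> {..<b}))" by (rule bounded_subset[OF bounded_ball])
    then show ?thesis by (rule emeasure_bounded_finite)
  qed
  define U where "U = N -` ({..<1} \<times> {..<1})"
  have U[measurable]: "U \<in> sets borel" by (simp add: U_def NE)
  define k where "k = emeasure lborel (S \<inter> U)"
  define K where "K = emeasure lborel U"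
  have K: "K \<noteq> \<infinity>" using fin[of 1 1] by (simp add: K_def U_def)
  have k: "k \<noteq> \<infinity>"
    using emeasure_mono[of "S \<inter> U" U lborel] K by (auto simp: k_def K_def top_unique)
  have K0: "K \<noteq> 0"
  proof -
    have "ball 0 1 \<subseteq> U"
    proof
      fix x :: 'a assume "x \<in> ball 0 1"
      then have "(norm x)\<^sup>2 < 1" by (simp add: power_less_one_iff)
      then show "x \<in> U"
        using sum_proj_sq_norms[OF L, of x] N_pos[of x] by (auto simp: U_def N_def mem_Times_iff)
    qed
    then have "emeasure lborel (ball (0::'a) 1) \<le> K" unfolding K_def by (intro emeasure_mono) auto
    then show ?thesis using emeasure_lborel_ball_bounds(1)[where 'a='a] by auto
  qed
  \<comment> \<open>Constancy of the proportion, cross-multiplied to avoid division in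
    \<open>ennreal\<close>.\<close>
  have scale: "K * emeasure lborel (S \<inter> N -` ({..<a} \<times> {..<b})) = k * emeasure lborel (N -` ({..<a} \<times> {..<b}))"
    for a b
  proof (cases "a > 0 \<and> b > 0")
    case False
    have "x \<notin> N -` ({..<a} \<times> {..<b})" for x
      using N_pos[of x] False by (auto simp: mem_Times_iff)
    then have "N -` ({..<a} \<times> {..<b}) = {}" by blast
    then show ?thesis by simp
  next
    case True
    \<comment> \<open>The square roots appear because squared norms scale by the squares of the
      factors.\<close>
    define T where "T = biscale L (1 / sqrt a) (1 / sqrt b)"
    have inv: "biscale L (sqrt a) (sqrt b) (T x) = x" for x
      using True by (simp add: T_def biscale_biscale[OF L] biscale_1_1)
    have T: "linear T" "inj T"
      using inv by (auto simp: T_def linear_biscale[OF L] intro: inj_on_inverseI)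
    obtain c where c: "\<And>A. A \<in> sets borel \<Longrightarrow> emeasure lborel (T -` A) = c * emeasure lborel A"
      using emeasure_lborel_linear_bij_scale[OF T] by blast
    have TU: "T -` U = N -` ({..<a} \<times> {..<b})"
      using True by (auto simp: U_def N_def T_def proj_sq_norms_biscale[OF L] mem_Times_iff power_divide)
    have TS: "T -` S = S"
    proof
      show "S \<subseteq> T -` S" using bic True by (auto simp: T_def)
      show "T -` S \<subseteq> S"
      proof
        fix x assume "x \<in> T -` S"
        then have "biscale L (sqrt a) (sqrt b) (T x) \<in> S" using bic True by auto
        then show "x \<in> S" by (simp add: inv)
      qed
    qed
    have "emeasure lborel (S \<inter> N -` ({..<a} \<times> {..<b})) = c * k"
      using c[of "S \<inter> U"] by (simp add: k_def TU TS)
    moreover have "emeasure lborel (N -` ({..<a} \<times> {..<b})) = c * K"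
      using c[of U] by (simp add: K_def TU)
    ultimately show ?thesis by (simp add: mult_ac)
  qed
  \<comment> \<open>The two sides of \<open>scale\<close> as measures on the plane. They agree and
    are finite on the quadrants, which form a generator stable under intersection.\<close>
  define M1 where "M1 = distr (density lborel (\<lambda>x. K * indicator S x)) borel N"
  define M2 where "M2 = distr (density lborel (\<lambda>x. k)) borel N"
  have M1: "emeasure M1 A = K * emeasure lborel (S \<inter> N -` A)" if [measurable]: "A \<in> sets borel" for A
    using NE[OF that] by (simp add: M1_def emeasure_distr emeasure_density mult.assoc nn_integral_cmult
        flip: indicator_inter_arith)
  have M2: "emeasure M2 A = k * emeasure lborel (N -` A)" if [measurable]: "A \<in> sets borel" for A
    using NE[OF that] by (simp add: M2_def emeasure_distr emeasure_density nn_integral_cmult)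
  have "M1 = M2"
  proof (rule measure_eqI_generator_eq)
    let ?E = "range (\<lambda>(a::real, b::real). {..<a} \<times> {..<b})"
    let ?A = "\<lambda>n::nat. {..<real n} \<times> {..<real n}"
    have "({..<a} \<times> {..<b}) \<inter> ({..<c} \<times> {..<d}) = {..<min a c} \<times> {..<min b d}" for a b c d :: real
      by auto
    then show "Int_stable ?E" by (fastforce simp: Int_stable_def)
    show "?E \<subseteq> Pow UNIV" by simp
    show "emeasure M1 X = emeasure M2 X" if "X \<in> ?E" for X
      using that by (auto simp: M1 M2 scale rect)
    have "sets (borel :: (real \<times> real) measure) = sigma_sets UNIV ?E"
      by (subst borel_prod_eq_lessThan_rectangles) simp
    then show "sets M1 = sigma_sets UNIV ?E" "sets M2 = sigma_sets UNIV ?E"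
      by (simp_all add: M1_def M2_def)
    show "range ?A \<subseteq> ?E" by auto
    show "\<Union> (range ?A) = UNIV"
    proof -
      have "x \<in> \<Union> (range ?A)" for x :: "real \<times> real"
      proof -
        obtain n :: nat where "max (fst x) (snd x) < real n" using reals_Archimedean2 by blast
        then show ?thesis by (auto simp: mem_Times_iff intro!: exI[of _ n])
      qed
      then show ?thesis by blast
    qed
    show "emeasure M1 (?A i) \<noteq> \<infinity>" for i
      using fin[of "real i" "real i"] k by (simp add: M1 scale rect ennreal_mult_eq_top_iff)
  qed
  define \<phi> where "\<phi> z = ennreal ((1 / sqrt (2 * pi)) ^ DIM('a) * exp (- (fst z + snd z) / 2))" for z :: "real \<times> real"
  have [measurable]: "\<phi> \<in> borel_measurable borel" unfolding \<phi>_def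
    by (intro measurable_compose[OF _ measurable_ennreal] borel_measurable_continuous_onI continuous_intros) simp
  have G: "std_gaussian = density lborel (\<lambda>x. \<phi> (N x))"
    by (simp add: std_gaussian_eq \<phi>_def N_def sum_proj_sq_norms[OF L])
  have main: "K * emeasure std_gaussian (S \<inter> N -` A) = k * emeasure std_gaussian (N -` A)"
    if A[measurable]: "A \<in> sets borel" for A
  proof -
    have "K * emeasure std_gaussian (S \<inter> N -` A) = (\<integral>\<^sup>+x. K * (\<phi> (N x) * indicator (S \<inter> N -` A) x) \<partial>lborel)"
      using NE[OF A] by (simp add: G emeasure_density nn_integral_cmult)
    also have "\<dots> = (\<integral>\<^sup>+x. (K * indicator S x) * (\<phi> (N x) * indicator A (N x)) \<partial>lborel)"
      by (intro nn_integral_cong) (auto simp: indicator_def)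
    also have "\<dots> = (\<integral>\<^sup>+z. \<phi> z * indicator A z \<partial>M1)"
      by (simp add: M1_def nn_integral_distr nn_integral_density)
    also have "\<dots> = (\<integral>\<^sup>+z. \<phi> z * indicator A z \<partial>M2)"
      by (simp add: \<open>M1 = M2\<close>)
    also have "\<dots> = (\<integral>\<^sup>+x. k * (\<phi> (N x) * indicator (N -` A) x) \<partial>lborel)"
      by (simp add: M2_def nn_integral_distr nn_integral_density indicator_vimage)
    also have "\<dots> = k * emeasure std_gaussian (N -` A)"
      using NE[OF A] by (simp add: G emeasure_density nn_integral_cmult)
    finally show ?thesis .
  qed
  interpret G: prob_space "std_gaussian :: 'a measure" by (rule prob_space_std_gaussian)
  \<comment> \<open>The whole plane as condition identifies the proportion with the Gaussian
    probability of \<open>S\<close>.\<close>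
  have "K * emeasure std_gaussian S = k"
    using main[of UNIV] G.emeasure_space_1 by simp
  then have "K * emeasure std_gaussian (S \<inter> N -` E) = K * (emeasure std_gaussian S * emeasure std_gaussian (N -` E))"
    using main[OF E] by (simp add: mult.assoc[symmetric])
  then show ?thesis using K K0 by (simp add: ennreal_mult_cancel_left N_def)
qed

subsection \<open>Exponential moments of the projection onto a subspace\<close>

lemma nn_integral_std_normal_exp_square:
  assumes "0 \<le> l"
  shows "(\<integral>\<^sup>+x. ennreal (std_normal_density x * exp (- l * x\<^sup>2)) \<partial>lborel) = ennreal (1 / sqrt (1 + 2 * l))"
proof -
  \<comment> \<open>Merging the exponents gives a centred normal density with inverse variance
    \<open>1 + 2 * l\<close>; the change of normalization leaves the factor
    \<open>\<sigma>\<close>.\<close>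
  define \<sigma> where "\<sigma> = 1 / sqrt (1 + 2 * l)"
  have \<sigma>: "\<sigma> > 0" using assms by (simp add: \<sigma>_def)
  have \<sigma>2: "\<sigma>\<^sup>2 = 1 / (1 + 2 * l)" using assms by (simp add: \<sigma>_def power_divide)
  have "std_normal_density x * exp (- l * x\<^sup>2) = \<sigma> * normal_density 0 \<sigma> x" for x
  proof -
    have "exp (- x\<^sup>2 / 2) * exp (- l * x\<^sup>2) = exp (- x\<^sup>2 / (2 * \<sigma>\<^sup>2))"
      using assms by (simp add: \<sigma>2 exp_add[symmetric] field_simps)
    moreover have "\<sigma> * (1 / sqrt (2 * pi * \<sigma>\<^sup>2)) = 1 / sqrt (2 * pi)"
      using \<sigma> by (simp add: real_sqrt_mult)
    moreover have "\<sigma> * normal_density 0 \<sigma> x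
        = \<sigma> * (1 / sqrt (2 * pi * \<sigma>\<^sup>2)) * exp (- x\<^sup>2 / (2 * \<sigma>\<^sup>2))"
      by (simp add: normal_density_def)
    ultimately have "\<sigma> * normal_density 0 \<sigma> x
        = 1 / sqrt (2 * pi) * (exp (- x\<^sup>2 / 2) * exp (- l * x\<^sup>2))"
      by (simp only:)
    then show ?thesis by (simp add: normal_density_def)
  qed
  then have "(\<integral>\<^sup>+x. ennreal (std_normal_density x * exp (- l * x\<^sup>2)) \<partial>lborel)
      = ennreal \<sigma> * (\<integral>\<^sup>+x. ennreal (normal_density 0 \<sigma> x) \<partial>lborel)"
    using \<sigma> by (simp add: ennreal_mult' nn_integral_cmult)
  also have "(\<integral>\<^sup>+x. ennreal (normal_density 0 \<sigma> x) \<partial>lborel) = 1"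
    using prob_space.emeasure_space_1[OF prob_space_normal_density[OF \<sigma>, of 0]]
    by (simp add: emeasure_density)
  finally show ?thesis by (simp add: \<sigma>_def)
qed

text \<open>By rotation invariance \<open>L\<close> may be replaced by a span of
  \<open>dim L\<close> coordinate vectors. There the integrand is a product over coordinates, and
  each coordinate in the span contributes one factor.\<close>

lemma nn_integral_exp_closest_point_subspace:
  fixes L :: "'a::euclidean_space set"
  assumes L: "subspace L" and l: "0 \<le> l"
  shows "(\<integral>\<^sup>+x. ennreal (exp (- l * fst (proj_sq_norms L x))) \<partial>std_gaussian)
    = ennreal ((1 / sqrt (1 + 2 * l)) ^ dim L)"
proof -
  have "dim L \<le> card (Basis :: 'a set)" using dim_subset_UNIV[of L] by simp
  then obtain B where B: "B \<subseteq> (Basis :: 'a set)" "card B = dim L" "finite B"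
    by (rule obtain_subset_with_card_n)
  define M where "M = span B"
  have M: "subspace M" by (simp add: M_def)
  have indep: "independent B" using independent_mono[OF independent_Basis B(1)] .
  have dimM: "dim L = dim M"
    using B dim_eq_card_independent[OF indep] by (simp add: M_def)
  have closest: "closest_point M x = (\<Sum>b\<in>B. (x \<bullet> b) *\<^sub>R b)" for x
    unfolding closest_point_subspace_iff[OF M]
  proof
    show "(\<Sum>b\<in>B. (x \<bullet> b) *\<^sub>R b) \<in> M"
      unfolding M_def by (intro span_sum span_scale span_base)
    have orth: "orthogonal (x - (\<Sum>b\<in>B. (x \<bullet> b) *\<^sub>R b)) c" if c: "c \<in> B" for c
    proof -
      have "(\<Sum>b\<in>B. (x \<bullet> b) * (b \<bullet> c)) = (\<Sum>b\<in>B. if b = c then x \<bullet> c else 0)"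
        using B(1) c by (intro sum.cong) (auto simp: inner_Basis subset_iff)
      then show ?thesis using c B(3) by (simp add: orthogonal_def inner_diff_left inner_sum_left)
    qed
    show "\<forall>y\<in>M. (x - (\<Sum>b\<in>B. (x \<bullet> b) *\<^sub>R b)) \<bullet> y = 0"
      using orthogonal_to_span[OF _ orth] by (auto simp: M_def orthogonal_def)
  qed
  have fstM: "fst (proj_sq_norms M x) = (\<Sum>b\<in>B. (x \<bullet> b)\<^sup>2)" for x
  proof -
    have "(x - closest_point M x) \<bullet> closest_point M x = 0"
      by (intro closest_point_subspace_orth closest_point_subspace_in M)
    then have "(norm (closest_point M x))\<^sup>2 = x \<bullet> closest_point M x"
      by (simp add: power2_norm_eq_inner inner_diff_left)
    then show ?thesis
      by (simp add: proj_sq_norms_def closest inner_sum_right power2_eq_square)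
  qed
  let ?h = "\<lambda>z::real \<times> real. ennreal (exp (- l * fst z))"
  have [measurable]: "(\<lambda>z::real \<times> real. exp (- (l * fst z))) \<in> borel_measurable borel"
    by (intro borel_measurable_continuous_onI continuous_intros)
  note [measurable] = borel_measurable_proj_sq_norms[OF closed_convex_cone_subspace]
  have "(\<integral>\<^sup>+x. ?h (proj_sq_norms L x) \<partial>std_gaussian) = (\<integral>\<^sup>+z. ?h z \<partial>distr std_gaussian borel (proj_sq_norms L))"
    using L by (subst nn_integral_distr) auto
  also have "\<dots> = (\<integral>\<^sup>+x. ?h (proj_sq_norms M x) \<partial>std_gaussian)"
    unfolding distr_proj_sq_norms_subspace_cong[OF L M dimM] using M by (subst nn_integral_distr) auto
  also have "\<dots> = (\<integral>\<^sup>+x. (\<Prod>b\<in>Basis. ennreal (std_normal_density (x \<bullet> b) * (if b \<in> B then exp (- l * (x \<bullet> b)\<^sup>2) else 1))) \<partial>lborel)"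
  proof -
    have "(\<Prod>b\<in>Basis. if b \<in> B then exp (- l * (x \<bullet> b)\<^sup>2) else 1) = exp (- l * (\<Sum>b\<in>B. (x \<bullet> b)\<^sup>2))" for x
      using B by (simp add: prod.If_cases Int_absorb1 exp_sum sum_distrib_left flip: sum_negf)
    then have "ennreal (\<Prod>b\<in>Basis. std_normal_density (x \<bullet> b)) * ?h (proj_sq_norms M x)
        = (\<Prod>b\<in>Basis. ennreal (std_normal_density (x \<bullet> b) * (if b \<in> B then exp (- l * (x \<bullet> b)\<^sup>2) else 1)))" for x
      by (subst prod_ennreal) (auto simp: prod.distrib fstM ennreal_mult'' )
    then show ?thesis
      unfolding std_gaussian_def using M by (subst nn_integral_density) auto
  qed
  also have "\<dots> = (\<Prod>b\<in>Basis. \<integral>\<^sup>+x. ennreal (std_normal_density x * (if b \<in> B then exp (- l * x\<^sup>2) else 1)) \<partial>lborel)"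
    by (rule nn_integral_lborel_prod) auto
  also have "\<dots> = (\<Prod>b\<in>(Basis::'a set). if b \<in> B then ennreal (1 / sqrt (1 + 2 * l)) else 1)"
    using nn_integral_std_normal_exp_square[OF l] nn_integral_std_normal_exp_square[of 0]
    by (intro prod.cong) auto
  also have "\<dots> = ennreal ((1 / sqrt (1 + 2 * l)) ^ dim L)"
    using B l by (simp add: prod.If_cases Int_absorb1 ennreal_power)
  finally show ?thesis .
qed

subsection \<open>The master formula for polyhedral cones\<close>

lemma nn_integral_std_gaussian_bicone_indep:
  fixes L :: "'a::euclidean_space set"
  assumes L: "subspace L" and S[measurable]: "S \<in> sets borel"
    and bic: "\<And>r s x. r > 0 \<Longrightarrow> s > 0 \<Longrightarrow> x \<in> S \<Longrightarrow> biscale L r s x \<in> S"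
    and h[measurable]: "h \<in> borel_measurable borel"
  shows "(\<integral>\<^sup>+x. h (proj_sq_norms L x) * indicator S x \<partial>std_gaussian)
    = emeasure std_gaussian S * (\<integral>\<^sup>+x. h (proj_sq_norms L x) \<partial>std_gaussian)"
proof -
  let ?N = "proj_sq_norms L"
  have N[measurable]: "?N \<in> borel_measurable borel"
    by (intro borel_measurable_proj_sq_norms closed_convex_cone_subspace L)
  have "distr (density std_gaussian (indicator S)) borel ?N
      = density (distr std_gaussian borel ?N) (\<lambda>_. emeasure std_gaussian S)" (is "?M1 = ?M2")
  proof (rule measure_eqI)
    fix A assume "A \<in> sets ?M1"
    then have A[measurable]: "A \<in> sets borel" by simp
    have NA[measurable]: "?N -` A \<in> sets borel" using measurable_sets_borel[OF N A] by simp
    have "emeasure ?M1 A = emeasure std_gaussian (S \<inter> ?N -` A)"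
      by (simp add: emeasure_distr emeasure_density flip: indicator_inter_arith)
    also have "\<dots> = emeasure std_gaussian S * emeasure std_gaussian (?N -` A)"
      by (rule std_gaussian_bicone_indep[OF L S bic A])
    also have "\<dots> = emeasure ?M2 A"
      by (simp add: emeasure_density nn_integral_cmult emeasure_distr)
    finally show "emeasure ?M1 A = emeasure ?M2 A" .
  qed simp
  then have "(\<integral>\<^sup>+z. h z \<partial>?M1) = (\<integral>\<^sup>+z. h z \<partial>?M2)" by simp
  then show ?thesis
    by (simp add: nn_integral_distr nn_integral_density nn_integral_cmult mult.commute)
qed

lemma measurable_compose_proj_sq_norms:
  assumes "closed_convex_cone C" "h \<in> measurable borel N"
  shows "(\<lambda>x. h (proj_sq_norms C x)) \<in> measurable std_gaussian N"
  using measurable_compose[OF borel_measurable_proj_sq_norms[OF assms(1)] assms(2)]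
  by (simp cong: measurable_cong_sets)

lemma polyhedral_nn_integral_eq:
  fixes C :: "'a::euclidean_space set" and L :: "nat \<Rightarrow> 'a set"
  assumes P: "polyhedral_cone C"
    and L: "\<And>k. k \<le> DIM('a) \<Longrightarrow> subspace (L k) \<and> dim (L k) = k"
    and h[measurable]: "h \<in> borel_measurable borel"
  shows "(\<integral>\<^sup>+x. h (proj_sq_norms C x) \<partial>std_gaussian)
    = (\<Sum>k\<le>DIM('a). ennreal (polyhedral_intrinsic_volume k C) * (\<integral>\<^sup>+x. h (proj_sq_norms (L k) x) \<partial>std_gaussian))"
proof -
  note C = polyhedral_cone_imp_closed_convex_cone[OF P]
  interpret G: prob_space "std_gaussian :: 'a measure" by (rule prob_space_std_gaussian)
  define \<F> where "\<F> = {F. cone_face F C}"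
  have fin: "finite \<F>" unfolding \<F>_def by (rule finite_cone_faces[OF P])
  define S where "S F = {x. closest_point C x \<in> rel_interior F}" for F
  define I where "I k = (\<integral>\<^sup>+x. h (proj_sq_norms (L k) x) \<partial>std_gaussian)" for k
  have [measurable]: "closest_point C \<in> borel_measurable borel" "proj_sq_norms C \<in> borel_measurable borel"
    by (intro borel_measurable_continuous_onI continuous_on_closest_point_cone C)
       (rule borel_measurable_proj_sq_norms[OF C])
  have S[measurable]: "S F \<in> sets borel" if "F \<in> \<F>" for F
  proof -
    have "closed F" using that cone_face_closed_convex_cone[OF C] by (auto simp: \<F>_def closed_cone)
    \<comment> \<open>A difference of two closed sets, hence Borel.\<close>
    then have "rel_interior F = F - rel_frontier F"
      using rel_interior_subset[of F] by (auto simp: rel_frontier_def)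
    moreover have "F - rel_frontier F \<in> sets borel"
      using \<open>closed F\<close> by (intro sets.Diff borel_closed closed_rel_frontier)
    ultimately have [measurable]: "rel_interior F \<in> sets borel" by simp
    have "S F = closest_point C -` rel_interior F" by (auto simp: S_def)
    then show ?thesis
      using measurable_sets_borel[of "closest_point C" borel "rel_interior F"] by simp
  qed
  have unique: "F = G" if "F \<in> \<F>" "G \<in> \<F>" "x \<in> S F" "x \<in> S G" for F G x
    using that cone_face_unique[OF C] by (auto simp: \<F>_def S_def)
  have disj: "disjoint_family_on S \<H>" if "\<H> \<subseteq> \<F>" for \<H>
    using that unique by (fastforce simp: disjoint_family_on_def)
  have cover: "(\<Sum>F\<in>\<F>. indicator (S F) x) = (1::ennreal)" for x
  proof -
    obtain F where F: "F \<in> \<F>" "x \<in> S F"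
      using in_rel_interior_cone_face[OF P closest_point_in_cone[OF C, of x]] by (auto simp: \<F>_def S_def)
    have "(\<Sum>G\<in>\<F>. indicator (S G) x) = (\<Sum>G\<in>\<F>. if G = F then 1 else (0::ennreal))"
      using unique F by (intro sum.cong) (auto simp: indicator_def)
    with F fin show ?thesis by simp
  qed
  have dimF: "dim F \<le> DIM('a)" for F :: "'a set" by (rule dim_subset_UNIV)
  have face: "(\<integral>\<^sup>+x. h (proj_sq_norms C x) * indicator (S F) x \<partial>std_gaussian)
      = emeasure std_gaussian (S F) * I (dim F)" if F: "F \<in> \<F>" for F
  proof -
    have cf: "cone_face F C" using F by (simp add: \<F>_def)
    note iff = closest_point_in_face_iff[OF C cf]
    have "(\<integral>\<^sup>+x. h (proj_sq_norms C x) * indicator (S F) x \<partial>std_gaussian)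
        = (\<integral>\<^sup>+x. h (proj_sq_norms (span F) x) * indicator (S F) x \<partial>std_gaussian)"
      by (intro nn_integral_cong)
         (auto simp: indicator_def S_def iff(2) proj_sq_norms_cone C closed_convex_cone_subspace)
    also have "\<dots> = emeasure std_gaussian (S F) * (\<integral>\<^sup>+x. h (proj_sq_norms (span F) x) \<partial>std_gaussian)"
    proof (rule nn_integral_std_gaussian_bicone_indep)
      \<comment> \<open>The component in \<open>span F\<close> stays in the relative interior of the
        cone \<open>F\<close>, and the orthogonal component stays in the polar cone; the face
        criterion needs nothing else.\<close>
      fix r s :: real and x assume rs: "r > 0" "s > 0" and x: "x \<in> S F"
      define p where "p = closest_point (span F) x"
      have p: "p \<in> rel_interior F" "x - p \<in> polar_cone C"
        using x iff(1)[of x] by (auto simp: S_def p_def)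
      have "r *\<^sub>R p \<in> rel_interior F"
        by (rule rel_interior_cone_scale[OF cone_face_closed_convex_cone[OF C cf] rs(1) p(1)])
      moreover have "biscale (span F) r s x - r *\<^sub>R p = s *\<^sub>R (x - p)"
        by (simp add: biscale_def p_def)
      moreover have "s *\<^sub>R (x - p) \<in> polar_cone C"
        using rs p(2) by (intro cone_scale[OF closed_convex_cone_polar]) auto
      ultimately show "biscale (span F) r s x \<in> S F"
        by (simp add: S_def iff(1) closest_point_biscale p_def[symmetric])
    qed (use S[OF F] in auto)
    also have "(\<integral>\<^sup>+x. h (proj_sq_norms (span F) x) \<partial>std_gaussian) = I (dim F)"
    proof -
      have sub: "subspace (L (dim F))" "dim (span F) = dim (L (dim F))"
        using L[OF dimF, of F] by auto
      have [measurable]: "proj_sq_norms (span F) \<in> borel_measurable borel" "proj_sq_norms (L (dim F)) \<in> borel_measurable borel"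
        using sub by (auto intro: borel_measurable_proj_sq_norms closed_convex_cone_subspace)
      have "(\<integral>\<^sup>+x. h (proj_sq_norms (span F) x) \<partial>std_gaussian) = (\<integral>\<^sup>+z. h z \<partial>distr std_gaussian borel (proj_sq_norms (span F)))"
        by (subst nn_integral_distr) auto
      also have "\<dots> = I (dim F)"
        unfolding distr_proj_sq_norms_subspace_cong[OF subspace_span sub] I_def
        by (subst nn_integral_distr) auto
      finally show ?thesis .
    qed
    finally show ?thesis .
  qed
  have vol: "(\<Sum>F | F \<in> \<F> \<and> dim F = k. emeasure std_gaussian (S F)) = ennreal (polyhedral_intrinsic_volume k C)" for k
  proof -
    have "(\<Sum>F | F \<in> \<F> \<and> dim F = k. emeasure std_gaussian (S F))
        = emeasure std_gaussian (\<Union>F\<in>{F \<in> \<F>. dim F = k}. S F)"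
      using fin S by (intro sum_emeasure disj) auto
    also have "(\<Union>F\<in>{F \<in> \<F>. dim F = k}. S F)
        = {g. \<exists>F. cone_face F C \<and> dim F = k \<and> closest_point C g \<in> rel_interior F}"
      by (auto simp: \<F>_def S_def)
    finally show ?thesis by (simp add: polyhedral_intrinsic_volume_def G.emeasure_eq_measure)
  qed
  have "(\<integral>\<^sup>+x. h (proj_sq_norms C x) \<partial>std_gaussian)
      = (\<integral>\<^sup>+x. (\<Sum>F\<in>\<F>. h (proj_sq_norms C x) * indicator (S F) x) \<partial>std_gaussian)"
    by (simp add: cover flip: sum_distrib_left)
  also have "\<dots> = (\<Sum>F\<in>\<F>. emeasure std_gaussian (S F) * I (dim F))"
    using S by (subst nn_integral_sum) (auto simp: face intro!: borel_measurable_times)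
  also have "\<dots> = (\<Sum>k\<le>DIM('a). \<Sum>F | F \<in> \<F> \<and> dim F = k. emeasure std_gaussian (S F) * I (dim F))"
    by (rule sum.group[symmetric]) (auto simp: fin dimF)
  also have "\<dots> = (\<Sum>k\<le>DIM('a). (\<Sum>F | F \<in> \<F> \<and> dim F = k. emeasure std_gaussian (S F)) * I k)"
    by (intro sum.cong) (auto simp: sum_distrib_right)
  finally show ?thesis by (simp add: vol I_def)
qed

lemma polyhedral_integral_eq:
  fixes C :: "'a::euclidean_space set" and L :: "nat \<Rightarrow> 'a set"
  assumes P: "polyhedral_cone C"
    and L: "\<And>k. k \<le> DIM('a) \<Longrightarrow> subspace (L k) \<and> dim (L k) = k"
    and h[measurable]: "h \<in> borel_measurable borel" and bdd: "\<And>z. 0 \<le> h z" "\<And>z. h z \<le> B"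
  shows "(\<integral>x. h (proj_sq_norms C x) \<partial>std_gaussian)
    = (\<Sum>k\<le>DIM('a). polyhedral_intrinsic_volume k C * (\<integral>x. h (proj_sq_norms (L k) x) \<partial>std_gaussian))"
proof -
  interpret G: prob_space "std_gaussian :: 'a measure" by (rule prob_space_std_gaussian)
  have *: "(\<integral>\<^sup>+x. ennreal (h (proj_sq_norms D x)) \<partial>std_gaussian) = ennreal (\<integral>x. h (proj_sq_norms D x) \<partial>std_gaussian)"
    if "closed_convex_cone D" for D :: "'a set"
  proof (rule nn_integral_eq_integral)
    note [measurable] = borel_measurable_proj_sq_norms[OF that]
    show "integrable std_gaussian (\<lambda>x. h (proj_sq_norms D x))"
      using bdd by (intro G.integrable_const_bound[where B = B]) auto
  qed (use bdd in auto)
  have nn: "0 \<le> (\<integral>x. h (proj_sq_norms D x) \<partial>std_gaussian)" for D :: "'a set"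
    using bdd by (intro Bochner_Integration.integral_nonneg) auto
  have vnn: "0 \<le> polyhedral_intrinsic_volume k C" for k
    by (simp add: polyhedral_intrinsic_volume_def)
  have "ennreal (\<integral>x. h (proj_sq_norms C x) \<partial>std_gaussian)
      = (\<Sum>k\<le>DIM('a). ennreal (polyhedral_intrinsic_volume k C) * ennreal (\<integral>x. h (proj_sq_norms (L k) x) \<partial>std_gaussian))"
    using polyhedral_nn_integral_eq[OF P L, of "\<lambda>z. ennreal (h z)"] L
    by (simp add: * polyhedral_cone_imp_closed_convex_cone[OF P] closed_convex_cone_subspace)
  also have "\<dots> = ennreal (\<Sum>k\<le>DIM('a). polyhedral_intrinsic_volume k C * (\<integral>x. h (proj_sq_norms (L k) x) \<partial>std_gaussian))"
    using nn vnn by (simp add: ennreal_mult[symmetric])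
  finally show ?thesis using nn vnn by (simp add: sum_nonneg)
qed

subsection \<open>Intrinsic volumes of general cones\<close>

text \<open>Lagrange interpolation: \<open>a k j\<close> is the coefficient of degree
  \<open>k\<close> of the \<open>j\<close>-th basis polynomial. The matrix is chosen before
  \<open>c\<close>, so one matrix serves all cones and the formula survives a limit.\<close>

lemma coefficients_from_values:
  fixes x :: "nat \<Rightarrow> real"
  assumes inj: "inj_on x {..d}"
  shows "\<exists>a :: nat \<Rightarrow> nat \<Rightarrow> real. \<forall>c. \<forall>k\<le>d. c k = (\<Sum>j\<le>d. a k j * (\<Sum>i\<le>d. c i * x j ^ i))"
proof -
  define n where "n j = (\<Prod>i\<in>{..d}-{j}. [:- x i, 1:])" for j
  define l where "l j = smult (1 / poly (n j) (x j)) (n j)" for j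
  have n0: "poly (n j) (x j) \<noteq> 0" if "j \<le> d" for j
    using inj that by (auto simp: n_def poly_prod inj_on_def)
  have l: "poly (l j) (x i) = (if i = j then 1 else 0)" if "i \<le> d" "j \<le> d" for i j
    using n0[OF that(2)] that by (auto simp: l_def) (auto simp: n_def poly_prod)
  have degl: "degree (l j) \<le> d" if "j \<le> d" for j
  proof -
    have "degree (n j) \<le> (\<Sum>i\<in>{..d}-{j}. 1)"
      unfolding n_def by (rule order_trans[OF degree_prod_sum_le]) (auto intro!: sum_mono)
    with that show ?thesis by (simp add: l_def)
  qed
  have "c k = (\<Sum>j\<le>d. coeff (l j) k * (\<Sum>i\<le>d. c i * x j ^ i))" if k: "k \<le> d" for c k
  proof -
    define p where "p = (\<Sum>i\<le>d. monom (c i) i)"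
    define q where "q = (\<Sum>j\<le>d. smult (poly p (x j)) (l j))"
    have "p = q"
    proof (rule poly_eqI_degree)
      have "poly q (x i) = poly p (x i)" if "i \<le> d" for i
      proof -
        have "poly q (x i) = (\<Sum>j\<le>d. if i = j then poly p (x j) else 0)"
          unfolding q_def poly_sum using that l by (intro sum.cong) auto
        then show ?thesis using that by simp
      qed
      then show "poly p z = poly q z" if "z \<in> x ` {..d}" for z using that by auto
      have "degree p \<le> d" "degree q \<le> d"
        unfolding p_def q_def
        using degl by (auto intro!: degree_sum_le order_trans[OF degree_monom_le] order_trans[OF degree_smult_le])
      then show "degree p < card (x ` {..d})" "degree q < card (x ` {..d})"
        by (simp_all add: card_image[OF inj])
    qed
    then have "coeff p k = coeff q k" by simp
    moreover have "coeff p k = c k" using k by (simp add: p_def coeff_sum)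
    moreover have "coeff q k = (\<Sum>j\<le>d. coeff (l j) k * (\<Sum>i\<le>d. c i * x j ^ i))"
      by (simp add: q_def coeff_sum p_def poly_sum poly_monom mult.commute)
    ultimately show ?thesis by simp
  qed
  then show ?thesis by (intro exI[of _ "\<lambda>k j. coeff (l j) k"]) blast
qed

text \<open>Continuity is asked on the closed quadrant, where all pairs of squared norms lie. A
  constant dominates because the Gaussian law is finite.\<close>

lemma integral_proj_sq_norms_tendsto:
  fixes C :: "'a::euclidean_space set" and h :: "real \<times> real \<Rightarrow> real"
  assumes C: "closed_convex_cone C" "\<And>i. closed_convex_cone (Cs i)"
    and lim: "(\<lambda>i. conic_hausdorff (Cs i) C) \<longlonglongrightarrow> 0"
    and h: "continuous_on ({0..} \<times> {0..}) h" "h \<in> borel_measurable borel" and bdd: "\<And>z. \<bar>h z\<bar> \<le> B"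
  shows "(\<lambda>i. \<integral>x. h (proj_sq_norms (Cs i) x) \<partial>std_gaussian) \<longlonglongrightarrow> (\<integral>x. h (proj_sq_norms C x) \<partial>std_gaussian)"
proof (rule integral_dominated_convergence)
  interpret G: prob_space "std_gaussian :: 'a measure" by (rule prob_space_std_gaussian)
  note [measurable] = borel_measurable_proj_sq_norms[OF C(1)] borel_measurable_proj_sq_norms[OF C(2)] h(2)
  show "(\<lambda>x. h (proj_sq_norms C x)) \<in> borel_measurable std_gaussian"
    "\<And>i. (\<lambda>x. h (proj_sq_norms (Cs i) x)) \<in> borel_measurable std_gaussian" by measurable
  show "integrable std_gaussian (\<lambda>x::'a. B)" by simp
  have "(\<lambda>i. h (proj_sq_norms (Cs i) x)) \<longlonglongrightarrow> h (proj_sq_norms C x)" for x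
    by (rule continuous_on_tendsto_compose[OF h(1) proj_sq_norms_tendsto[OF C lim]])
       (auto simp: proj_sq_norms_def)
  then show "AE x in std_gaussian. (\<lambda>i. h (proj_sq_norms (Cs i) x)) \<longlonglongrightarrow> h (proj_sq_norms C x)" by simp
  show "\<And>i. AE x in std_gaussian. norm (h (proj_sq_norms (Cs i) x)) \<le> B" using bdd by simp
qed

lemma exists_subspaces_of_all_dims:
  obtains L :: "nat \<Rightarrow> 'a::euclidean_space set"
  where "\<And>k. k \<le> DIM('a) \<Longrightarrow> subspace (L k) \<and> dim (L k) = k"
proof -
  have "\<exists>L :: 'a set. subspace L \<and> dim L = k" if "k \<le> DIM('a)" for k
    using choose_subspace_of_subspace[of k "UNIV :: 'a set"] that by auto
  then show ?thesis using that by metis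
qed

text \<open>For a polyhedral cone the Laplace transform of \<open>\<parallel>\<Pi>\<^sub>C g\<parallel>\<^sup>2\<close> at \<open>l\<close> is the polynomial
  \<open>\<Sum>\<^sub>k v\<^sub>k t\<^sup>k\<close> at \<open>t = (1 + 2 l) powr (-1/2)\<close>. Its values at \<open>DIM('a) + 1\<close> points determine the
  \<open>v\<^sub>k\<close> linearly, and they are continuous in the cone.\<close>

lemma intrinsic_volume_tendsto:
  fixes C :: "'a::euclidean_space set"
  assumes C: "closed_convex_cone C" and Cs: "\<And>i. polyhedral_cone (Cs i)"
    and lim: "(\<lambda>i. conic_hausdorff (Cs i) C) \<longlonglongrightarrow> 0" and k: "k \<le> DIM('a)"
  shows "(\<lambda>i. polyhedral_intrinsic_volume k (Cs i)) \<longlonglongrightarrow> intrinsic_volume k C"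
proof -
  obtain L :: "nat \<Rightarrow> 'a set" where L: "\<And>k. k \<le> DIM('a) \<Longrightarrow> subspace (L k) \<and> dim (L k) = k"
    using exists_subspaces_of_all_dims[where 'a='a] by blast
  \<comment> \<open>The interpolation node belonging to the Laplace parameter
    \<open>l = j\<close>.\<close>
  define t where "t j = 1 / sqrt (1 + 2 * real j)" for j
  \<comment> \<open>The truncation by \<open>max 0\<close> bounds the function by 1 on the whole
    plane without changing it on the quadrant.\<close>
  define h where "h j z = exp (- real j * max 0 (fst z))" for j and z :: "real \<times> real"
  have h: "continuous_on A (h j)" "h j \<in> borel_measurable borel" "\<bar>h j z\<bar> \<le> 1" "0 \<le> h j z" for j A z
    unfolding h_def by (intro borel_measurable_continuous_onI continuous_intros | simp)+
  define l where "l j D = (\<integral>x. h j (proj_sq_norms D x) \<partial>std_gaussian)" for j and D :: "'a set"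
  have inj: "inj_on t {..DIM('a)}" by (auto simp: t_def inj_on_def)
  obtain a :: "nat \<Rightarrow> nat \<Rightarrow> real"
    where a: "\<forall>c. \<forall>k\<le>DIM('a). c k = (\<Sum>j\<le>DIM('a). a k j * (\<Sum>i\<le>DIM('a). c i * t j ^ i))"
    using coefficients_from_values[OF inj] ..
  \<comment> \<open>The candidate value: defined for every cone, continuous along approximating
    sequences, and equal to the intrinsic volume on polyhedral cones.\<close>
  define W where "W k D = (\<Sum>j\<le>DIM('a). a k j * l j D)" for k D
  have lL: "l j (L i) = t j ^ i" if "i \<le> DIM('a)" for i j
  proof -
    have sub: "subspace (L i)" "dim (L i) = i"
      by (rule L[OF that, THEN conjunct1]) (rule L[OF that, THEN conjunct2])
    have "h j (proj_sq_norms (L i) x) = exp (- real j * fst (proj_sq_norms (L i) x))" for x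
      by (simp add: h_def proj_sq_norms_def)
    then have "(\<integral>\<^sup>+x. ennreal (h j (proj_sq_norms (L i) x)) \<partial>std_gaussian) = ennreal (t j ^ i)"
      using nn_integral_exp_closest_point_subspace[OF sub(1), of "real j"]
      by (simp only: sub(2) t_def of_nat_0_le_iff)
    moreover have "l j (L i) = enn2real (\<integral>\<^sup>+x. ennreal (h j (proj_sq_norms (L i) x)) \<partial>std_gaussian)"
      unfolding l_def
    proof (rule integral_eq_nn_integral)
      show "(\<lambda>x. h j (proj_sq_norms (L i) x)) \<in> borel_measurable std_gaussian"
        by (intro measurable_compose_proj_sq_norms closed_convex_cone_subspace h(2) sub)
    qed (simp add: h(4))
    ultimately show ?thesis by (simp add: t_def)
  qed
  have poly: "polyhedral_intrinsic_volume k D = W k D" if "polyhedral_cone D" for D :: "'a set"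
  proof -
    have l: "l j D = (\<Sum>i\<le>DIM('a). polyhedral_intrinsic_volume i D * t j ^ i)" for j
      unfolding l_def using h(3)[of j]
      by (subst polyhedral_integral_eq[OF that L h(2,4), of _ 1])
         (auto simp: abs_le_iff lL[unfolded l_def])
    have "polyhedral_intrinsic_volume k D
        = (\<Sum>j\<le>DIM('a). a k j * (\<Sum>i\<le>DIM('a). polyhedral_intrinsic_volume i D * t j ^ i))"
      using a[THEN spec, of "\<lambda>i. polyhedral_intrinsic_volume i D"] k by blast
    then show ?thesis by (simp only: W_def l)
  qed
  have tendsto: "(\<lambda>i. polyhedral_intrinsic_volume k (Ds i)) \<longlonglongrightarrow> W k C"
    if Ds: "\<And>i. polyhedral_cone (Ds i)" and lim: "(\<lambda>i. conic_hausdorff (Ds i) C) \<longlonglongrightarrow> 0" for Ds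
    unfolding poly[OF Ds] unfolding W_def l_def
    by (intro tendsto_intros integral_proj_sq_norms_tendsto[OF C _ lim h(1,2,3)]
        polyhedral_cone_imp_closed_convex_cone Ds)
  have "intrinsic_volume k C = W k C"
  proof (cases "polyhedral_cone C")
    case True
    then show ?thesis by (simp add: intrinsic_volume_def poly)
  next
    case False
    have "(THE v. \<forall>Cs :: nat \<Rightarrow> 'a set.
             (\<forall>i. polyhedral_cone (Cs i)) \<and> (\<lambda>i. conic_hausdorff (Cs i) C) \<longlonglongrightarrow> 0 \<longrightarrow>
             (\<lambda>i. polyhedral_intrinsic_volume k (Cs i)) \<longlonglongrightarrow> v) = W k C"
    proof (rule the_equality)
      fix v assume "\<forall>Cs :: nat \<Rightarrow> 'a set.
             (\<forall>i. polyhedral_cone (Cs i)) \<and> (\<lambda>i. conic_hausdorff (Cs i) C) \<longlonglongrightarrow> 0 \<longrightarrow>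
             (\<lambda>i. polyhedral_intrinsic_volume k (Cs i)) \<longlonglongrightarrow> v"
      \<comment> \<open>Uniqueness in the definite description needs at least one approximating
        sequence; the given \<open>Cs\<close> provides it.\<close>
      then have "(\<lambda>i. polyhedral_intrinsic_volume k (Cs i)) \<longlonglongrightarrow> v" using Cs lim by blast
      then show "v = W k C" using tendsto[OF Cs lim] by (rule LIMSEQ_unique)
    qed (use tendsto in blast)
    then show ?thesis using False by (simp add: intrinsic_volume_def)
  qed
  with tendsto[OF Cs lim] show ?thesis by simp
qed

subsection \<open>From continuous to Borel functions\<close>

lemma intrinsic_volume_nonneg:
  fixes C :: "'a::euclidean_space set"
  assumes C: "closed_convex_cone C" and k: "k \<le> DIM('a)"
  shows "0 \<le> intrinsic_volume k C"
proof -
  obtain Cs :: "nat \<Rightarrow> 'a set"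
    where Cs: "\<And>i. polyhedral_cone (Cs i)" "(\<lambda>i. conic_hausdorff (Cs i) C) \<longlonglongrightarrow> 0"
    using polyhedral_cones_dense[OF C] by blast
  show ?thesis
    by (rule LIMSEQ_le_const[OF intrinsic_volume_tendsto[OF C Cs k]])
       (auto simp: polyhedral_intrinsic_volume_def)
qed

text \<open>The integrands decrease to the indicator of a closed set. The empty set is excluded
  because \<open>infdist\<close> to it is 0 by convention, which would make the integrands
  constantly 1.\<close>

lemma measure_vimage_closed_tendsto:
  fixes D :: "'a::euclidean_space set" and A :: "(real \<times> real) set"
  assumes D: "closed_convex_cone D" and A: "closed A" "A \<noteq> {}"
  shows "(\<lambda>n. \<integral>x. max 0 (1 - real n * infdist (proj_sq_norms D x) A) \<partial>std_gaussian)
    \<longlonglongrightarrow> measure std_gaussian (proj_sq_norms D -` A)"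
proof -
  interpret G: prob_space "std_gaussian :: 'a measure" by (rule prob_space_std_gaussian)
  note N[measurable] = borel_measurable_proj_sq_norms[OF D]
  have [measurable]: "A \<in> sets borel" using A by (simp add: borel_closed)
  have NA: "proj_sq_norms D -` A \<in> sets borel" using measurable_sets_borel[OF N] by simp
  have "(\<lambda>n. \<integral>x. max 0 (1 - real n * infdist (proj_sq_norms D x) A) \<partial>std_gaussian)
      \<longlonglongrightarrow> (\<integral>x. indicator (proj_sq_norms D -` A) x \<partial>std_gaussian)"
  proof (rule integral_dominated_convergence)
    have "(\<lambda>x. infdist (proj_sq_norms D x) A) \<in> borel_measurable borel"
      by (intro borel_measurable_continuous_onI continuous_on_infdist continuous_on_proj_sq_norms D)
    then show "(\<lambda>x. max 0 (1 - real n * infdist (proj_sq_norms D x) A)) \<in> borel_measurable std_gaussian" for n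
      by measurable
    show "integrable std_gaussian (\<lambda>x::'a. 1::real)" by simp
    show "(indicator (proj_sq_norms D -` A) :: 'a \<Rightarrow> real) \<in> borel_measurable std_gaussian"
      using NA by simp
    have "(\<lambda>n. max 0 (1 - real n * infdist (proj_sq_norms D x) A)) \<longlonglongrightarrow> indicator (proj_sq_norms D -` A) x" for x
    proof (cases "proj_sq_norms D x \<in> A")
      case True
      then show ?thesis by simp
    next
      case False
      define e where "e = infdist (proj_sq_norms D x) A"
      have e: "e > 0"
        using False A in_closed_iff_infdist_zero[OF A] infdist_nonneg[of "proj_sq_norms D x" A]
        by (simp add: e_def less_le)
      obtain m :: nat where "1 / e < real m" using reals_Archimedean2 by blast
      then have m: "1 < real m * e" using e by (simp add: field_simps)
      have "\<forall>\<^sub>F n in sequentially. max 0 (1 - real n * e) = 0"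
      proof (rule eventually_sequentiallyI[of m])
        fix n assume "m \<le> n"
        then have "real m * e \<le> real n * e" using e by simp
        with m show "max 0 (1 - real n * e) = 0" by simp
      qed
      then show ?thesis using False by (simp add: tendsto_eventually flip: e_def)
    qed
    then show "AE x in std_gaussian. (\<lambda>n. max 0 (1 - real n * infdist (proj_sq_norms D x) A))
        \<longlonglongrightarrow> indicator (proj_sq_norms D -` A) x" by simp
    show "AE x in std_gaussian. norm (max 0 (1 - real n * infdist (proj_sq_norms D x) A)) \<le> 1" for n
      by (simp add: infdist_nonneg)
  qed
  then show ?thesis using NA by simp
qed

section \<open>The mixture identity for a fixed cone, from continuous to nonnegative Borel
  functions\<close>

context
  fixes C :: "'a::euclidean_space set" and L :: "nat \<Rightarrow> 'a set"
  assumes C: "closed_convex_cone C"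
    and L: "\<And>k. k \<le> DIM('a) \<Longrightarrow> subspace (L k) \<and> dim (L k) = k"
begin

lemma integral_continuous_eq:
  fixes h :: "real \<times> real \<Rightarrow> real"
  assumes h: "continuous_on UNIV h" and bdd: "\<And>z. 0 \<le> h z" "\<And>z. h z \<le> B"
  shows "(\<integral>x. h (proj_sq_norms C x) \<partial>std_gaussian)
    = (\<Sum>k\<le>DIM('a). intrinsic_volume k C * (\<integral>x. h (proj_sq_norms (L k) x) \<partial>std_gaussian))"
proof -
  have hm: "h \<in> borel_measurable borel" by (rule borel_measurable_continuous_onI[OF h])
  have B: "\<bar>h z\<bar> \<le> B" for z using bdd by (simp add: abs_le_iff order_trans[of _ 0])
  obtain Cs :: "nat \<Rightarrow> 'a set"
    where Cs: "\<And>i. polyhedral_cone (Cs i)" "(\<lambda>i. conic_hausdorff (Cs i) C) \<longlonglongrightarrow> 0"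
    using polyhedral_cones_dense[OF C] by blast
  have "(\<lambda>i. \<integral>x. h (proj_sq_norms (Cs i) x) \<partial>std_gaussian) \<longlonglongrightarrow> (\<integral>x. h (proj_sq_norms C x) \<partial>std_gaussian)"
    by (rule integral_proj_sq_norms_tendsto[OF C _ Cs(2) continuous_on_subset[OF h] hm B])
       (auto intro: polyhedral_cone_imp_closed_convex_cone Cs)
  moreover have "(\<lambda>i. \<integral>x. h (proj_sq_norms (Cs i) x) \<partial>std_gaussian)
      \<longlonglongrightarrow> (\<Sum>k\<le>DIM('a). intrinsic_volume k C * (\<integral>x. h (proj_sq_norms (L k) x) \<partial>std_gaussian))"
  proof -
    have "(\<integral>x. h (proj_sq_norms (Cs i) x) \<partial>std_gaussian)
      = (\<Sum>k\<le>DIM('a). polyhedral_intrinsic_volume k (Cs i) * (\<integral>x. h (proj_sq_norms (L k) x) \<partial>std_gaussian))" for i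
      by (rule polyhedral_integral_eq[OF Cs(1) L hm bdd])
    then show ?thesis
      by (simp only:) (intro tendsto_intros intrinsic_volume_tendsto[OF C Cs], simp)
  qed
  ultimately show ?thesis by (rule LIMSEQ_unique)
qed

text \<open>Closed sets are stable under intersection and generate the Borel sets, so the identity
  spreads from them through complements and disjoint unions.\<close>

lemma measure_vimage_eq:
  assumes "A \<in> sets borel"
  shows "measure std_gaussian (proj_sq_norms C -` A)
    = (\<Sum>k\<le>DIM('a). intrinsic_volume k C * measure std_gaussian (proj_sq_norms (L k) -` A))"
proof -
  interpret G: prob_space "std_gaussian :: 'a measure" by (rule prob_space_std_gaussian)
  have LC: "closed_convex_cone (L k)" if "k \<le> DIM('a)" for k
    using L[OF that] by (simp add: closed_convex_cone_subspace)
  have meas: "proj_sq_norms D -` A \<in> sets borel" if "closed_convex_cone D" "A \<in> sets borel" for A and D :: "'a set"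
    using measurable_sets_borel[OF borel_measurable_proj_sq_norms[OF that(1)] that(2)] by simp
  have closed: "measure std_gaussian (proj_sq_norms C -` A)
    = (\<Sum>k\<le>DIM('a). intrinsic_volume k C * measure std_gaussian (proj_sq_norms (L k) -` A))"
    if A: "closed A" for A
  proof (cases "A = {}")
    case False
    let ?h = "\<lambda>n z. max 0 (1 - real n * infdist z A)"
    have "continuous_on UNIV (?h n)" for n by (intro continuous_intros continuous_on_infdist)
    then have "(\<integral>x. ?h n (proj_sq_norms C x) \<partial>std_gaussian)
        = (\<Sum>k\<le>DIM('a). intrinsic_volume k C * (\<integral>x. ?h n (proj_sq_norms (L k) x) \<partial>std_gaussian))" for n
      by (rule integral_continuous_eq[where B = 1]) (auto simp: infdist_nonneg)
    moreover have "(\<lambda>n. \<Sum>k\<le>DIM('a). intrinsic_volume k C * (\<integral>x. ?h n (proj_sq_norms (L k) x) \<partial>std_gaussian))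
        \<longlonglongrightarrow> (\<Sum>k\<le>DIM('a). intrinsic_volume k C * measure std_gaussian (proj_sq_norms (L k) -` A))"
      by (intro tendsto_intros measure_vimage_closed_tendsto LC A False) auto
    ultimately show ?thesis
      using measure_vimage_closed_tendsto[OF C A False] by (simp add: LIMSEQ_unique)
  qed simp
  \<comment> \<open>The closed set \<open>UNIV\<close> gives total mass 1 of the weights, which the
    complement case consumes.\<close>
  have one: "(\<Sum>k\<le>DIM('a). intrinsic_volume k C) = 1"
    using closed[of UNIV] G.prob_space by simp
  have closed_stable: "Int_stable (Collect closed :: (real \<times> real) set set)" "Collect closed \<subseteq> Pow (UNIV :: (real \<times> real) set)"
    by (auto simp: Int_stable_def)
  have "A \<in> sigma_sets UNIV (Collect closed)"
    using assms by (subst (asm) borel_eq_closed) simp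
  with closed_stable show ?thesis
  proof (induction rule: sigma_sets_induct_disjoint)
    case (basic A)
    then show ?case by (simp add: closed)
  next
    case empty
    show ?case by simp
  next
    case (compl A)
    have A: "A \<in> sets borel" using compl(1) by (subst borel_eq_closed) simp
    have diff: "measure std_gaussian (proj_sq_norms D -` (UNIV - A)) = 1 - measure std_gaussian (proj_sq_norms D -` A)"
      if "closed_convex_cone D" for D :: "'a set"
      using G.prob_compl[of "proj_sq_norms D -` A"] meas[OF that A] by (simp add: vimage_Diff)
    show ?case
      using compl.IH by (simp add: diff C LC one algebra_simps sum_subtractf)
  next
    case (union A)
    have A: "A i \<in> sets borel" for i using union(2) by (subst borel_eq_closed) auto
    have sums: "(\<lambda>i. measure std_gaussian (proj_sq_norms D -` A i)) sums measure std_gaussian (proj_sq_norms D -` (\<Union>i. A i))"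
      if D: "closed_convex_cone D" for D :: "'a set"
    proof -
      have "disjoint_family (\<lambda>i. proj_sq_norms D -` A i)"
        using union(1) unfolding disjoint_family_on_def by blast
      then show ?thesis
        unfolding vimage_UN using meas[OF D A] by (intro G.finite_measure_UNION) auto
    qed
    have "(\<lambda>i. measure std_gaussian (proj_sq_norms C -` A i)) sums
        (\<Sum>k\<le>DIM('a). intrinsic_volume k C * measure std_gaussian (proj_sq_norms (L k) -` (\<Union>i. A i)))"
      unfolding union(3) by (intro sums_sum sums_mult sums LC) simp
    with sums[OF C] show ?case by (rule sums_unique2)
  qed
qed

text \<open>Stated in \<open>ennreal\<close> so that unbounded functions and infinite values are
  covered by monotone approximation alone.\<close>

lemma nn_integral_proj_sq_norms_eq:
  assumes "h \<in> borel_measurable borel"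
  shows "(\<integral>\<^sup>+x. h (proj_sq_norms C x) \<partial>std_gaussian)
    = (\<Sum>k\<le>DIM('a). ennreal (intrinsic_volume k C) * (\<integral>\<^sup>+x. h (proj_sq_norms (L k) x) \<partial>std_gaussian))"
  using assms
proof (induction rule: borel_measurable_induct)
  interpret G: prob_space "std_gaussian :: 'a measure" by (rule prob_space_std_gaussian)
  have LC: "closed_convex_cone (L k)" if "k \<le> DIM('a)" for k
    using L[OF that] by (simp add: closed_convex_cone_subspace)
  note m = measurable_compose_proj_sq_norms
  {
    case (cong f g)
    then show ?case by simp
  next
    case (set A)
    have "(\<integral>\<^sup>+x. indicator A (proj_sq_norms D x) \<partial>std_gaussian) = ennreal (measure std_gaussian (proj_sq_norms D -` A))"
      if D: "closed_convex_cone D" for D :: "'a set"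
    proof -
      have "proj_sq_norms D -` A \<in> sets borel"
        using measurable_sets_borel[OF borel_measurable_proj_sq_norms[OF D] set] by simp
      then show ?thesis by (simp add: G.emeasure_eq_measure flip: indicator_vimage)
    qed
    moreover have "ennreal (\<Sum>k\<le>DIM('a). intrinsic_volume k C * measure std_gaussian (proj_sq_norms (L k) -` A))
        = (\<Sum>k\<le>DIM('a). ennreal (intrinsic_volume k C * measure std_gaussian (proj_sq_norms (L k) -` A)))"
      by (rule sum_ennreal[symmetric]) (simp add: intrinsic_volume_nonneg[OF C])
    ultimately show ?case
      by (simp add: C LC measure_vimage_eq[OF set] ennreal_mult intrinsic_volume_nonneg[OF C])
  next
    case (mult u c)
    have "(\<integral>\<^sup>+x. c * u (proj_sq_norms D x) \<partial>std_gaussian) = c * (\<integral>\<^sup>+x. u (proj_sq_norms D x) \<partial>std_gaussian)"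
      if "closed_convex_cone D" for D :: "'a set"
      using m[OF that] mult by (intro nn_integral_cmult) simp
    then show ?case using mult by (simp add: C LC sum_distrib_left mult_ac)
  next
    case (add u v)
    have "(\<integral>\<^sup>+x. v (proj_sq_norms D x) + u (proj_sq_norms D x) \<partial>std_gaussian)
        = (\<integral>\<^sup>+x. v (proj_sq_norms D x) \<partial>std_gaussian) + (\<integral>\<^sup>+x. u (proj_sq_norms D x) \<partial>std_gaussian)"
      if "closed_convex_cone D" for D :: "'a set"
      using m[OF that] add by (intro nn_integral_add) simp_all
    then show ?case using add by (simp add: C LC sum.distrib distrib_left)
  next
    case (seq U)
    have mono: "U i z \<le> U j z" if "i \<le> j" for i j z
      by (rule le_funD[OF incseqD[OF seq(3) that]])
    have sup: "(\<integral>\<^sup>+x. (SUP i. U i) (proj_sq_norms D x) \<partial>std_gaussian)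
        = (SUP i. \<integral>\<^sup>+x. U i (proj_sq_norms D x) \<partial>std_gaussian)"
      if "closed_convex_cone D" for D :: "'a set"
      using m[OF that seq(1)] mono unfolding SUP_apply
      by (intro nn_integral_monotone_convergence_SUP) (simp_all add: incseq_def le_fun_def)
    have inc: "incseq (\<lambda>i. \<integral>\<^sup>+x. U i (proj_sq_norms D x) \<partial>std_gaussian)" for D :: "'a set"
      using mono by (simp add: incseq_def nn_integral_mono)
    have "(\<Sum>k\<le>DIM('a). ennreal (intrinsic_volume k C) * (\<integral>\<^sup>+x. (SUP i. U i) (proj_sq_norms (L k) x) \<partial>std_gaussian))
        = (\<Sum>k\<le>DIM('a). SUP i. ennreal (intrinsic_volume k C) * (\<integral>\<^sup>+x. U i (proj_sq_norms (L k) x) \<partial>std_gaussian))"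
      by (intro sum.cong refl) (simp only: sup[OF LC] SUP_mult_left_ennreal atMost_iff)
    also have "\<dots> = (SUP i. \<Sum>k\<le>DIM('a). ennreal (intrinsic_volume k C) * (\<integral>\<^sup>+x. U i (proj_sq_norms (L k) x) \<partial>std_gaussian))"
      using inc by (intro ennreal_SUP_sum[symmetric]) (auto simp: incseq_def intro!: mult_left_mono)
    finally show ?case by (simp only: sup[OF C] seq.IH)
  }
qed

end

theorem theorem3p1:
  fixes f :: "real \<times> real \<Rightarrow> real"
    and L :: "nat \<Rightarrow> 'a::euclidean_space set"
    and C :: "'a set"
  assumes "f \<in> borel_measurable (restrict_space borel ({0..} \<times> {0..}))"
    and "\<And>k. k \<le> DIM('a) \<Longrightarrow> subspace (L k) \<and> dim (L k) = k"
    and "closed_convex_cone C"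
    and "integrable std_gaussian (projection_functional f C)"
    and "\<And>k. k \<le> DIM('a) \<Longrightarrow> integrable std_gaussian (projection_functional f (L k))"
  shows "phi f C = (\<Sum>k=0..DIM('a). phi f (L k) * intrinsic_volume k C)"
proof -
  \<comment> \<open>Measurability of \<open>f\<close> is assumed only on the quadrant. The extension
    by 0 is Borel on the plane and agrees with \<open>f\<close> at every pair of squared
    norms.\<close>
  define f' where "f' z = indicator ({0..} \<times> {0..}) z *\<^sub>R f z" for z
  have quad: "({0..} \<times> {0..} :: (real \<times> real) set) \<inter> space borel \<in> sets borel"
    by (simp add: borel_closed closed_Times)
  have f'[measurable]: "f' \<in> borel_measurable borel"
    using assms(1) borel_measurable_restrict_space_iff[OF quad, of f] by (simp add: f'_def[abs_def])
  have pf: "projection_functional f D = (\<lambda>x. f' (proj_sq_norms D x))" for D :: "'a set"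
    by (auto simp: fun_eq_iff projection_functional_eq f'_def proj_sq_norms_def)
  \<comment> \<open>Needed because \<open>enn2real\<close> sends infinity to 0 and is additive only
    on finite terms.\<close>
  have fin: "(\<integral>\<^sup>+x. ennreal (s * f' (proj_sq_norms (L k) x)) \<partial>std_gaussian) < top"
    if "k \<le> DIM('a)" "\<bar>s\<bar> = 1" for k s
  proof -
    have "(\<integral>\<^sup>+x. ennreal (s * f' (proj_sq_norms (L k) x)) \<partial>std_gaussian)
        \<le> (\<integral>\<^sup>+x. ennreal (norm (f' (proj_sq_norms (L k) x))) \<partial>std_gaussian)"
      using that(2) by (intro nn_integral_mono ennreal_leI) (auto simp: abs_if split: if_splits)
    also have "\<dots> < top"
      using assms(5)[OF that(1)] by (simp add: pf integrable_iff_bounded)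
    finally show ?thesis .
  qed
  \<comment> \<open>Used with \<open>s = 1\<close> and \<open>s = - 1\<close>:
    \<open>ennreal\<close> cuts negative values to 0, so these are the positive and negative
    parts.\<close>
  have part: "enn2real (\<integral>\<^sup>+x. ennreal (s * f' (proj_sq_norms C x)) \<partial>std_gaussian)
      = (\<Sum>k\<le>DIM('a). intrinsic_volume k C * enn2real (\<integral>\<^sup>+x. ennreal (s * f' (proj_sq_norms (L k) x)) \<partial>std_gaussian))"
    if "\<bar>s\<bar> = 1" for s
  proof -
    have "(\<lambda>z. ennreal (s * f' z)) \<in> borel_measurable borel" by measurable
    from nn_integral_proj_sq_norms_eq[OF assms(3,2) this]
    have "enn2real (\<integral>\<^sup>+x. ennreal (s * f' (proj_sq_norms C x)) \<partial>std_gaussian)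
        = enn2real (\<Sum>k\<le>DIM('a). ennreal (intrinsic_volume k C) * (\<integral>\<^sup>+x. ennreal (s * f' (proj_sq_norms (L k) x)) \<partial>std_gaussian))"
      by simp
    also have "\<dots> = (\<Sum>k\<le>DIM('a). enn2real (ennreal (intrinsic_volume k C) * (\<integral>\<^sup>+x. ennreal (s * f' (proj_sq_norms (L k) x)) \<partial>std_gaussian)))"
      using fin[OF _ that] by (subst enn2real_sum) (auto simp: ennreal_mult_less_top)
    finally show ?thesis
      by (simp add: enn2real_mult intrinsic_volume_nonneg[OF assms(3)])
  qed
  have phi: "phi f D = enn2real (\<integral>\<^sup>+x. ennreal (1 * f' (proj_sq_norms D x)) \<partial>std_gaussian)
      - enn2real (\<integral>\<^sup>+x. ennreal (- 1 * f' (proj_sq_norms D x)) \<partial>std_gaussian)"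
    if "integrable std_gaussian (projection_functional f D)" for D :: "'a set"
    using real_lebesgue_integral_def[OF that] by (simp add: phi_def pf)
  have "phi f C = (\<Sum>k\<le>DIM('a). intrinsic_volume k C * phi f (L k))"
    unfolding phi[OF assms(4)]
    by (subst (1 2) part) (auto simp: phi[OF assms(5)] right_diff_distrib sum_subtractf)
  then show ?thesis by (simp add: mult.commute atMost_atLeast0)
qed

end
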